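(* Let $k\ge 1$. A graph $G$ is $k$-level if and only if $G$ has no minor isomorphic to $\operatorname{cone}(H)$ for any minimally biconnected graph $H$ on $k+1$ vertices.
   Context: A graph $G$ is $k$-level if the base configuration $V_{\mathcal{M}(G)}=\{\mathbf{1}_T: T \text{ a spanning forest of } G\}\subset\mathbb{R}^{E(G)}$ of its graphic matroid is $k$-level, i.e. every facet-defining affine function takes at most $k$ distinct values on it (for a finite point set $V$ and affine $\ell\ge 0$ on $V$, $\{v:\ell(v)=0\}$ is a face; inclusion-maximal faces other than $V$ are facets, and the corresponding $\ell$ are facet-defining). The cone over $H=(V,E)$ with apex $w\notin V$ is $(V\cup\{w\},E\cup\{wv:v\in V\})$. A graph is minimally biconnected if it is biconnected and deleting any edge destroys biconnectivity. *)

theory Defs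
  imports Complex_Main
begin

definition graph :: "'a set \<Rightarrow> 'a set set \<Rightarrow> bool" where
  "graph V E \<longleftrightarrow> finite V \<and> (\<forall>e\<in>E. \<exists>u v. e = {u, v} \<and> u \<noteq> v \<and> u \<in> V \<and> v \<in> V)"

definition reach :: "'a set set \<Rightarrow> 'a \<Rightarrow> 'a \<Rightarrow> bool" where
  "reach F = (\<lambda>x y. {x, y} \<in> F)\<^sup>*\<^sup>*"

definition connected_graph :: "'a set \<Rightarrow> 'a set set \<Rightarrow> bool" where
  "connected_graph V E \<longleftrightarrow> (\<forall>u\<in>V. \<forall>v\<in>V. reach E u v)"

definition induced_edges :: "'a set set \<Rightarrow> 'a set \<Rightarrow> 'a set set" where
  "induced_edges E B = {e \<in> E. e \<subseteq> B}"

definition biconnected :: "'a set \<Rightarrow> 'a set set \<Rightarrow> bool" where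
  "biconnected V E \<longleftrightarrow> card V \<ge> 2 \<and> connected_graph V E \<and>
     (\<forall>v\<in>V. connected_graph (V - {v}) (induced_edges E (V - {v})))"

definition minimally_biconnected :: "'a set \<Rightarrow> 'a set set \<Rightarrow> bool" where
  "minimally_biconnected V E \<longleftrightarrow> biconnected V E \<and> (\<forall>e\<in>E. \<not> biconnected V (E - {e}))"

definition cone_vertices :: "'a set \<Rightarrow> 'a option set" where
  "cone_vertices V = insert None (Some ` V)"

definition cone_edges :: "'a set \<Rightarrow> 'a set set \<Rightarrow> 'a option set set" where
  "cone_edges V E = ((\<lambda>e. Some ` e) ` E) \<union> {{None, Some v} | v. v \<in> V}"

definition is_minor :: "'b set \<Rightarrow> 'b set set \<Rightarrow> 'a set \<Rightarrow> 'a set set \<Rightarrow> bool" where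
  "is_minor VH EH VG EG \<longleftrightarrow> (\<exists>\<beta> :: 'b \<Rightarrow> 'a set.
     (\<forall>v\<in>VH. \<beta> v \<noteq> {} \<and> \<beta> v \<subseteq> VG \<and> connected_graph (\<beta> v) (induced_edges EG (\<beta> v))) \<and>
     (\<forall>u\<in>VH. \<forall>v\<in>VH. u \<noteq> v \<longrightarrow> \<beta> u \<inter> \<beta> v = {}) \<and>
     (\<forall>u v. {u, v} \<in> EH \<longrightarrow> (\<exists>x\<in>\<beta> u. \<exists>y\<in>\<beta> v. {x, y} \<in> EG)))"

definition forest :: "'a set set \<Rightarrow> bool" where
  "forest F \<longleftrightarrow> (\<forall>e\<in>F. \<forall>u v. e = {u, v} \<longrightarrow> \<not> reach (F - {e}) u v)"

text \<open>Spanning forests = bases of the graphic matroid (maximal acyclic edge sets).\<close>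
definition spanning_forest :: "'a set set \<Rightarrow> 'a set set \<Rightarrow> bool" where
  "spanning_forest E T \<longleftrightarrow> T \<subseteq> E \<and> forest T \<and> (\<forall>e\<in>E - T. \<not> forest (insert e T))"

text \<open>Points of R^E are functions E \<Rightarrow> real (zero outside E); the base configuration.\<close>
definition base_config :: "'a set set \<Rightarrow> ('a set \<Rightarrow> real) set" where
  "base_config E = {(\<lambda>e. if e \<in> T then 1 else 0) | T. spanning_forest E T}"

definition affine_fun_on :: "'i set \<Rightarrow> (('i \<Rightarrow> real) \<Rightarrow> real) \<Rightarrow> bool" where
  "affine_fun_on I l \<longleftrightarrow> (\<exists>a c. \<forall>x. l x = c + (\<Sum>i\<in>I. a i * x i))"

definition is_face :: "'i set \<Rightarrow> ('i \<Rightarrow> real) set \<Rightarrow> ('i \<Rightarrow> real) set \<Rightarrow> bool" where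
  "is_face I P F \<longleftrightarrow> (\<exists>l. affine_fun_on I l \<and> (\<forall>v\<in>P. l v \<ge> 0) \<and> F = {v \<in> P. l v = 0})"

definition is_facet :: "'i set \<Rightarrow> ('i \<Rightarrow> real) set \<Rightarrow> ('i \<Rightarrow> real) set \<Rightarrow> bool" where
  "is_facet I P F \<longleftrightarrow> is_face I P F \<and> F \<noteq> P \<and>
     (\<forall>F'. is_face I P F' \<and> F' \<noteq> P \<and> F \<subseteq> F' \<longrightarrow> F' = F)"

definition facet_defining :: "'i set \<Rightarrow> ('i \<Rightarrow> real) set \<Rightarrow> (('i \<Rightarrow> real) \<Rightarrow> real) \<Rightarrow> bool" where
  "facet_defining I P l \<longleftrightarrow> affine_fun_on I l \<and> (\<forall>v\<in>P. l v \<ge> 0) \<and> is_facet I P {v \<in> P. l v = 0}"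

definition k_level_config :: "'i set \<Rightarrow> ('i \<Rightarrow> real) set \<Rightarrow> nat \<Rightarrow> bool" where
  "k_level_config I P k \<longleftrightarrow> (\<forall>l. facet_defining I P l \<longrightarrow> card (l ` P) \<le> k)"

definition k_level_graph :: "'a set \<Rightarrow> 'a set set \<Rightarrow> nat \<Rightarrow> bool" where
  "k_level_graph V E k \<longleftrightarrow> k_level_config E (base_config E) k"

end

theory Submission
  imports Defs
begin

text \<open>Both directions go through the functions \<open>r(X) - |T \<inter> X|\<close> on spanning forests \<open>T\<close>.

If \<open>cone(H)\<close> is a minor, fix a spanning forest of the branch sets and suitable further edges. The
spanning forests that differ from this only in edges between branch sets form a face of the base
configuration. On it the number of edges between branch sets of vertices of \<open>H\<close> takes all values
\<open>0,...,k\<close>, and its maximum cuts out a facet: since \<open>H - i\<close> is connected for every \<open>i\<close>, any affine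
function that vanishes there has equal coefficients on all edges at \<open>i\<close>. A facet function of a
face is, up to a factor, the restriction of one of the whole configuration.

Conversely, by the greedy algorithm every facet consists of the forests \<open>T\<close> such that \<open>T \<inter> X\<close> spans
some fixed edge set \<open>X\<close>. Choosing \<open>X\<close> minimal makes it biconnected, and the same facet is cut out by the complement of
a single part of the contraction of \<open>X\<close>: an edge inside \<open>U = \<Union>X\<close> or all edges at one component \<open>W\<close>
of the rest of the graph. The number of values is then at most the number of attachments of \<open>W\<close> in
\<open>U\<close>, and \<open>(U, X)\<close> contracts onto any \<open>k + 1\<close> of them without losing biconnectedness.\<close>

section \<open>Forests\<close>

text \<open>A cone has one apex, but the variation of \<open>T \<inter> X\<close> adds up
  contributions from all parts around \<open>X\<close>. The count therefore has to move to one part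
  \<open>Y\<close>, and two facts permit this. Functions that define the same facet are
  proportional, so any edge set that is spanned on the whole facet but not everywhere may replace
  \<open>X\<close>. And all spanning forests have the same size, so
  \<open>T \<inter> (E - Y)\<close> shrinks exactly as \<open>T \<inter> Y\<close> grows.

  Then \<open>k + 1\<close> values give two forests whose numbers of edges at \<open>W\<close>
  differ by at least \<open>k\<close>. Such a difference is at most the number of attachments minus
  one, which is where the \<open>k + 1\<close> vertices of \<open>H\<close> come from.

  The obstacle in the contraction is that merging two vertices may create a cut vertex, so the edge
  to contract has to be chosen with care.

  Cardinality bounds come from comparing a forest with a set of pairs that spans it. Such a set may
  leave \<open>E\<close>, so a star on chosen vertices often takes the place of an explicit
  tree.\<close>

lemma reach_refl [simp]: "reach F x x"
  by (simp add: reach_def)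

lemma reach_edge: "{x, y} \<in> F \<Longrightarrow> reach F x y"
  by (auto simp: reach_def)

lemma reach_trans [trans]: "reach F x y \<Longrightarrow> reach F y z \<Longrightarrow> reach F x z"
  unfolding reach_def by (rule rtranclp_trans)

lemma reach_image:
  assumes "reach F x y" and "\<And>u v. {u, v} \<in> F \<Longrightarrow> reach G (h u) (h v)"
  shows "reach G (h x) (h y)"
  using assms(1) unfolding reach_def
proof (induction rule: rtranclp_induct)
  case (step y z)
  then show ?case
    using assms(2)[of y z] unfolding reach_def by (blast intro: rtranclp_trans)
qed simp

lemma reach_sym: "reach F x y \<Longrightarrow> reach F y x"
  unfolding reach_def
proof (induction rule: rtranclp_induct)
  case (step y z)
  then have "{z, y} \<in> F" by (simp add: insert_commute)
  then show ?case using step.IH by (rule converse_rtranclp_into_rtranclp)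
qed simp

lemma reach_mono: "reach F x y \<Longrightarrow> F \<subseteq> G \<Longrightarrow> reach G x y"
  by (rule reach_image[where h = "\<lambda>x. x"]) (auto intro: reach_edge)

lemma reach_leave:
  assumes "reach F x y" "x \<in> A" "y \<notin> A"
  shows "\<exists>a\<in>A. \<exists>b. b \<notin> A \<and> {a, b} \<in> F"
  using assms unfolding reach_def
  by (induction rule: rtranclp_induct) auto

lemma reach_closed:
  assumes "reach F x y" "x \<in> A" "\<And>a b. {a, b} \<in> F \<Longrightarrow> a \<in> A \<Longrightarrow> b \<in> A"
  shows "y \<in> A"
  using reach_leave[OF assms(1,2)] assms(3) by blast

lemma reach_insert_cases:
  assumes "reach (insert {u, v} F) x y"
  shows "reach F x y \<or> (reach F x u \<and> reach F v y) \<or> (reach F x v \<and> reach F u y)"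
  using assms unfolding reach_def[of "insert {u, v} F"]
proof (induction rule: rtranclp_induct)
  case (step y z)
  then consider "{y, z} \<in> F" | "y = u" "z = v" | "y = v" "z = u"
    by (auto simp: doubleton_eq_iff)
  then show ?case
  proof cases
    case 1
    then have "reach F y z" by (rule reach_edge)
    with step.IH show ?thesis by (blast intro: reach_trans)
  qed (use step.IH in auto)
qed simp

text \<open>Containment of \<open>A\<close> in the closure of \<open>B\<close> in the graphic
  matroid. No rank function is introduced: ranks are compared through \<open>spans\<close> and the
  sizes of forests.\<close>

definition spans :: "'a set set \<Rightarrow> 'a set set \<Rightarrow> bool" where
  "spans A B \<longleftrightarrow> (\<forall>u v. {u, v} \<in> A \<longrightarrow> reach B u v)"

lemma spansD: "spans A B \<Longrightarrow> {u, v} \<in> A \<Longrightarrow> reach B u v"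
  by (auto simp: spans_def)

lemma spans_reach: "spans A B \<Longrightarrow> reach A x y \<Longrightarrow> reach B x y"
  using reach_image[of A x y B "\<lambda>x. x"] by (auto simp: spans_def)

lemma spans_refl [simp]: "spans A A"
  by (auto simp: spans_def reach_edge)

lemma spans_mono: "spans A B \<Longrightarrow> A' \<subseteq> A \<Longrightarrow> B \<subseteq> B' \<Longrightarrow> spans A' B'"
  unfolding spans_def by (meson reach_mono subsetD)

lemma spans_trans [trans]: "spans A B \<Longrightarrow> spans B C \<Longrightarrow> spans A C"
  unfolding spans_def using spans_reach spans_def by metis

lemma spans_Un: "spans A C \<Longrightarrow> spans B C \<Longrightarrow> spans (A \<union> B) C"
  by (auto simp: spans_def)

lemma forest_empty [simp]: "forest {}"
  by (simp add: forest_def)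

lemma forestD: "forest F \<Longrightarrow> {u, v} \<in> F \<Longrightarrow> \<not> reach (F - {{u, v}}) u v"
  by (auto simp: forest_def)

lemma forest_subset: "forest F \<Longrightarrow> G \<subseteq> F \<Longrightarrow> forest G"
  unfolding forest_def by (meson Diff_mono order_refl reach_mono subset_eq)

text \<open>If an old edge came to lie on a cycle through \<open>{u, v}\<close>, the rest of that
  cycle would already join \<open>u\<close> and \<open>v\<close> in \<open>F\<close>.\<close>

lemma forest_insert:
  assumes "forest F" "\<not> reach F u v"
  shows "forest (insert {u, v} F)"
  unfolding forest_def
proof (intro ballI allI impI notI)
  fix e x y
  assume e: "e \<in> insert {u, v} F" "e = {x, y}" and r: "reach (insert {u, v} F - {e}) x y"
  show False
  proof (cases "e = {u, v}")
    case True
    then have "reach F x y" using r by (auto intro: reach_mono)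
    then show False using True e assms(2) reach_sym by (metis doubleton_eq_iff)
  next
    case False
    then have eF: "{x, y} \<in> F" and "insert {u, v} F - {e} = insert {u, v} (F - {{x, y}})"
      using e by auto
    then have "reach (F - {{x, y}}) x y \<or> (reach (F - {{x, y}}) x u \<and> reach (F - {{x, y}}) v y)
      \<or> (reach (F - {{x, y}}) x v \<and> reach (F - {{x, y}}) u y)"
      using r reach_insert_cases[of u v "F - {{x, y}}" x y] by simp
    moreover have "\<not> reach (F - {{x, y}}) x y" using forestD[OF assms(1) eF] .
    ultimately have "(reach F x u \<and> reach F v y) \<or> (reach F x v \<and> reach F u y)"
      using reach_mono by (metis Diff_subset)
    then show False
      using assms(2) reach_edge[OF eF] by (meson reach_sym reach_trans)
  qed
qed

text \<open>Without \<open>{u, v}\<close> the forest \<open>A\<close> separates \<open>u\<close>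
  from \<open>v\<close>. A path from \<open>u\<close> to \<open>v\<close> in \<open>B\<close> has to
  leave the component of \<open>u\<close>, and the edge on which it leaves can be inserted
  instead.\<close>

lemma forest_exchange:
  assumes "forest A" "{u, v} \<in> A" "reach B u v"
  shows "\<exists>x y. {x, y} \<in> B \<and> {x, y} \<notin> A - {{u, v}} \<and> forest (insert {x, y} (A - {{u, v}}))"
proof -
  let ?A = "A - {{u, v}}"
  obtain x y where xy: "reach ?A u x" "\<not> reach ?A u y" "{x, y} \<in> B"
    using reach_leave[OF assms(3), of "{x. reach ?A u x}"] forestD[OF assms(1,2)] by auto
  then have n: "\<not> reach ?A x y" using reach_trans by metis
  then have "{x, y} \<notin> ?A" using reach_edge by metis
  moreover have "forest (insert {x, y} ?A)"
    by (rule forest_insert) (use assms(1) forest_subset n in \<open>blast+\<close>)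
  ultimately show ?thesis using xy(3) by blast
qed

text \<open>Steinitz exchange: each step keeps the size of \<open>A\<close> and moves one more
  element into \<open>B\<close>. As \<open>forest\<close> and \<open>spans\<close> say nothing about
  members that are not pairs, the last assumption excludes these.\<close>

lemma forest_card_le:
  assumes "finite A" "finite B" "forest A" "spans A B" "\<And>e. e \<in> A \<Longrightarrow> \<exists>u v. e = {u, v}"
  shows "card A \<le> card B"
  using assms
proof (induction "card (A - B)" arbitrary: A rule: less_induct)
  case less
  show ?case
  proof (cases "A \<subseteq> B")
    case True
    then show ?thesis using less.prems card_mono by blast
  next
    case False
    then obtain u v where e: "{u, v} \<in> A" "{u, v} \<notin> B" using less.prems(5) by blast
    let ?A = "A - {{u, v}}"
    obtain x y where xy: "{x, y} \<in> B" "{x, y} \<notin> ?A" "forest (insert {x, y} ?A)"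
      using forest_exchange[OF less.prems(3) e(1) spansD[OF less.prems(4) e(1)]] by blast
    let ?A' = "insert {x, y} ?A"
    have lt: "card (?A' - B) < card (A - B)"
      using e xy less.prems(1) by (intro psubset_card_mono) auto
    have sp: "spans ?A' B"
      using less.prems(4) xy(1) by (auto simp: spans_def doubleton_eq_iff reach_edge insert_commute)
    have ex: "\<exists>u v. e = {u, v}" if "e \<in> ?A'" for e
      using that less.prems(5) by (metis DiffD1 insertE)
    have fin: "finite ?A'" using less.prems(1) by simp
    have "card ?A' \<le> card B"
      by (rule less.hyps[OF lt fin less.prems(2) xy(3) sp ex])
    moreover have "card ?A' = card A"
      using xy(2) less.prems(1) card_Suc_Diff1[OF less.prems(1) e(1)] by (simp del: card_Diff_insert)
    ultimately show ?thesis by simp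
  qed
qed

section \<open>The graphic matroid: extension, exchange and equal size of its bases\<close>

locale finite_graph =
  fixes V :: "'a set" and E :: "'a set set"
  assumes graph: "graph V E"
begin

lemma finite_V: "finite V"
  using graph by (simp add: graph_def)

lemma edgeE:
  assumes "e \<in> E"
  obtains u v where "e = {u, v}" "u \<noteq> v" "u \<in> V" "v \<in> V"
  using assms graph unfolding graph_def by blast

lemma edge_pair: "{u, v} \<in> E \<Longrightarrow> u \<noteq> v \<and> u \<in> V \<and> v \<in> V"
  using graph unfolding graph_def by (fastforce simp: doubleton_eq_iff)

lemma finite_E: "finite E"
proof (rule finite_subset)
  show "E \<subseteq> Pow V" using edgeE by blast
qed (simp add: finite_V)

lemma finite_edges: "A \<subseteq> E \<Longrightarrow> finite A"
  using finite_E finite_subset by blast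

lemma card_le:
  assumes "A \<subseteq> E" "forest A" "finite B" "spans A B"
  shows "card A \<le> card B"
  by (rule forest_card_le) (use assms edgeE finite_edges in \<open>blast+\<close>)

lemma forest_insert_iff:
  assumes "forest F" "{u, v} \<notin> F"
  shows "forest (insert {u, v} F) \<longleftrightarrow> \<not> reach F u v"
proof
  assume "forest (insert {u, v} F)"
  then show "\<not> reach F u v" using forestD[of "insert {u, v} F" u v] assms(2) by simp
qed (rule forest_insert[OF assms(1)])

lemma spanning_forest_iff: "spanning_forest E T \<longleftrightarrow> T \<subseteq> E \<and> forest T \<and> spans E T"
proof
  assume a: "spanning_forest E T"
  have "reach T u v" if "{u, v} \<in> E" for u v
    using a that forest_insert[of T u v] reach_edge[of u v T] unfolding spanning_forest_def by blast
  then show "T \<subseteq> E \<and> forest T \<and> spans E T"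
    using a unfolding spanning_forest_def spans_def by blast
next
  assume a: "T \<subseteq> E \<and> forest T \<and> spans E T"
  have "\<not> forest (insert e T)" if "e \<in> E - T" for e
  proof -
    obtain u v where "e = {u, v}" using \<open>e \<in> E - T\<close> edgeE by blast
    then show ?thesis using that a forest_insert_iff spansD by (metis DiffE)
  qed
  then show "spanning_forest E T" using a unfolding spanning_forest_def by blast
qed

lemma extend_forest:
  assumes "forest A" "A \<subseteq> B" "B \<subseteq> E"
  obtains T where "A \<subseteq> T" "T \<subseteq> B" "forest T" "spans B T"
proof -
  let ?P = "\<lambda>T. A \<subseteq> T \<and> T \<subseteq> B \<and> forest T"
  have "finite B" using assms(3) finite_edges by blast
  then have "\<forall>T. ?P T \<longrightarrow> card T < Suc (card B)"
    by (simp add: card_mono less_Suc_eq_le)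
  moreover have "?P A" using assms(1,2) by simp
  ultimately have "\<exists>T. ?P T \<and> (\<forall>T'. ?P T' \<longrightarrow> card T' \<le> card T)"
    using ex_has_greatest_nat[of ?P A card "Suc (card B)"] by blast
  then obtain T where T: "?P T" "\<And>T'. ?P T' \<Longrightarrow> card T' \<le> card T"
    by metis
  have "reach T u v" if "{u, v} \<in> B" for u v
  proof (rule ccontr)
    assume n: "\<not> reach T u v"
    then have "forest (insert {u, v} T)" using T(1) by (intro forest_insert) auto
    then have "?P (insert {u, v} T)" using T(1) that by blast
    then have "card (insert {u, v} T) \<le> card T" using T(2) by blast
    moreover have "{u, v} \<notin> T" using n reach_edge by metis
    moreover have "finite T" using T(1) \<open>finite B\<close> finite_subset by blast
    ultimately show False by simp
  qed
  then show thesis using that T(1) unfolding spans_def by blast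
qed

lemma extend_spanning_forest:
  assumes "forest A" "A \<subseteq> B" "B \<subseteq> E" "spans E B"
  obtains T where "A \<subseteq> T" "T \<subseteq> B" "spanning_forest E T"
proof -
  obtain T where "A \<subseteq> T" "T \<subseteq> B" "forest T" "spans B T"
    using extend_forest assms by metis
  then show thesis
    using that spanning_forest_iff spans_trans assms by (meson order_trans)
qed

lemma spanning_forest_card:
  assumes "spanning_forest E T" "spanning_forest E T'"
  shows "card T = card T'"
  using assms card_le spans_mono finite_edges unfolding spanning_forest_iff
  by (metis order_antisym order_refl)

lemma spanning_forest_if_card:
  assumes "spanning_forest E T" "T' \<subseteq> E" "spans E T'" "card T' \<le> card T"
  shows "spanning_forest E T'"
proof -
  obtain T'' where T'': "T'' \<subseteq> T'" "spanning_forest E T''"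
    using extend_spanning_forest[of "{}" T'] assms by auto
  then have "card T' \<le> card T''" using assms spanning_forest_card by metis
  then have "T'' = T'" using T''(1) assms(2) finite_edges card_seteq by blast
  then show ?thesis using T'' by simp
qed

lemma spanning_forest_if_forest_card:
  assumes "spanning_forest E T" "T' \<subseteq> E" "forest T'" "card T' = card T"
  shows "spanning_forest E T'"
proof -
  obtain T'' where T'': "T' \<subseteq> T''" "spanning_forest E T''"
    using extend_spanning_forest[OF assms(3,2) order_refl spans_refl] by metis
  then have "card T'' = card T'" using assms spanning_forest_card by metis
  then have "T'' = T'"
    using T'' finite_edges[of T''] card_subset_eq[of T'' T'] unfolding spanning_forest_iff by simp
  then show ?thesis using T'' by simp
qed

lemma spanning_forest_exchange:
  assumes "spanning_forest E T" "spanning_forest E T'" "e \<in> T - T'"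
  obtains f where "f \<in> T' - T" "spanning_forest E (insert f (T - {e}))"
proof -
  have T: "T \<subseteq> E" "forest T" "T' \<subseteq> E" "spans E T'" using assms spanning_forest_iff by blast+
  then obtain u v where e: "e = {u, v}" using assms(3) edgeE by blast
  then obtain x y where xy: "{x, y} \<in> T'" "{x, y} \<notin> T - {e}" "forest (insert {x, y} (T - {e}))"
    using forest_exchange[of T u v T'] T assms(3) spansD[OF T(4), of u v] by (metis DiffD1 subsetD)
  then have "{x, y} \<in> T' - T" using assms(3) by blast
  moreover have "finite T" using T finite_edges by blast
  then have "card (insert {x, y} (T - {e})) = card T"
    using xy(2) assms(3) card_Suc_Diff1[of T e] by simp
  then have "spanning_forest E (insert {x, y} (T - {e}))"
    using spanning_forest_if_forest_card[OF assms(1) _ xy(3)] xy(1) T by blast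
  ultimately show thesis using that by blast
qed

text \<open>The equality case of \<open>card (T \<inter> X) \<le> r(X)\<close>: among spanning
  forests, the tight ones are those that meet \<open>X\<close> in the most edges, by
  \<open>tight_max\<close> and \<open>tight_iff_card\<close>. For \<open>X \<subseteq> E\<close>
  they form a face.\<close>

definition tight :: "'a set set \<Rightarrow> 'a set set \<Rightarrow> bool" where
  "tight X T \<longleftrightarrow> spans X (T \<inter> X)"

lemma tight_max:
  assumes "spanning_forest E T" "spanning_forest E T'" "tight X T"
  shows "card (T' \<inter> X) \<le> card (T \<inter> X)"
  using assms card_le[of "T' \<inter> X" "T \<inter> X"] finite_edges forest_subset spans_mono
  unfolding tight_def spanning_forest_iff by (metis inf.coboundedI1 inf_le1 inf_le2 order_refl)

lemma tight_iff_card: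
  assumes "spanning_forest E T" "spanning_forest E T'" "tight X T" "X \<subseteq> E"
  shows "tight X T' \<longleftrightarrow> card (T' \<inter> X) = card (T \<inter> X)"
proof
  assume "tight X T'"
  then show "card (T' \<inter> X) = card (T \<inter> X)" using assms tight_max order_antisym by metis
next
  assume c: "card (T' \<inter> X) = card (T \<inter> X)"
  have T: "T' \<inter> X \<subseteq> X" "forest (T' \<inter> X)"
    using assms forest_subset spanning_forest_iff by blast+
  obtain A where A: "T' \<inter> X \<subseteq> A" "A \<subseteq> X" "forest A" "spans X A"
    using extend_forest[OF T(2,1) assms(4)] by metis
  have "card A \<le> card (T \<inter> X)"
    using A assms(3,4) finite_edges[of "T \<inter> X"] spans_mono[of X "T \<inter> X" A "T \<inter> X"]
    unfolding tight_def by (intro card_le) auto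
  then have "A = T' \<inter> X" using A c finite_edges assms(4) by (metis card_seteq subset_trans)
  then show "tight X T'" using A unfolding tight_def by simp
qed

lemma exists_tight:
  assumes "X \<subseteq> E"
  obtains T where "spanning_forest E T" "tight X T"
proof -
  obtain A where A: "A \<subseteq> X" "forest A" "spans X A"
    using extend_forest[of "{}" X] assms by auto
  obtain T where T: "A \<subseteq> T" "spanning_forest E T"
    using extend_spanning_forest[OF A(2) order_trans[OF A(1) assms] order_refl spans_refl] by metis
  then have "A \<subseteq> T \<inter> X" using A by blast
  then have "tight X T"
    unfolding tight_def by (rule spans_mono[OF A(3) order_refl])
  then show thesis using that T by blast
qed

end

section \<open>Facets of finite point configurations\<close>

lemma affine_fun_on_comb:
  assumes "affine_fun_on I f" "affine_fun_on I g"
  shows "affine_fun_on I (\<lambda>x. s * f x + t * g x)"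
proof -
  obtain a c b d where "\<forall>x. f x = c + (\<Sum>i\<in>I. a i * x i)" "\<forall>x. g x = d + (\<Sum>i\<in>I. b i * x i)"
    using assms unfolding affine_fun_on_def by metis
  then have "s * f x + t * g x = (s * c + t * d) + (\<Sum>i\<in>I. (s * a i + t * b i) * x i)" for x
    by (simp add: algebra_simps sum.distrib sum_distrib_left)
  then show ?thesis unfolding affine_fun_on_def by fast
qed

lemma affine_fun_on_const: "affine_fun_on I (\<lambda>x. c)"
  unfolding affine_fun_on_def by (intro exI[of _ "\<lambda>_. 0"] exI[of _ c]) simp

text \<open>The largest multiple of \<open>q\<close> below \<open>h\<close>, found as the least
  ratio \<open>h / q\<close>. The difference keeps the common zeros of \<open>h\<close> and
  \<open>q\<close> and vanishes at some point where \<open>q\<close> does not; this is how strictly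
  larger faces are produced.\<close>

lemma ratio_touch:
  fixes h q :: "'v \<Rightarrow> real"
  assumes "finite P" "\<forall>v\<in>P. h v \<ge> 0" "\<forall>v\<in>P. q v \<ge> 0" "\<exists>v\<in>P. q v \<noteq> 0"
  obtains t where "t \<ge> 0" "\<forall>v\<in>P. h v - t * q v \<ge> 0" "\<exists>v\<in>P. q v \<noteq> 0 \<and> h v - t * q v = 0"
proof -
  let ?Q = "{v \<in> P. q v \<noteq> 0}" and ?r = "\<lambda>v. h v / q v"
  have fin: "finite (?r ` ?Q)" and ne: "?r ` ?Q \<noteq> {}" using assms by auto
  define t where "t = Min (?r ` ?Q)"
  then obtain v where v: "v \<in> ?Q" "t = ?r v" using Min_in[OF fin ne] by auto
  have le: "t * q w \<le> h w" if "w \<in> P" for w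
  proof (cases "q w = 0")
    case False
    then have "t \<le> ?r w"
      using that fin unfolding t_def by (intro Min_le) auto
    moreover have "q w > 0" using False that assms(3) by (metis order_le_less)
    ultimately show ?thesis by (simp add: pos_le_divide_eq)
  qed (use that assms(2) in simp)
  show thesis
    by (rule that[of t]) (use v le assms(2,3) in auto)
qed

text \<open>Subtracting the right multiple of \<open>l\<close> from \<open>h\<close> keeps the zeros
  of \<open>l\<close> and adds one. A facet has no larger proper face above it, so the difference
  vanishes on all of \<open>P\<close>.\<close>

lemma facet_functions_proportional:
  assumes "finite P" "facet_defining I P l" "affine_fun_on I h" "\<forall>v\<in>P. h v \<ge> 0"
    and "\<And>v. v \<in> P \<Longrightarrow> l v = 0 \<Longrightarrow> h v = 0" and "\<exists>v\<in>P. h v \<noteq> 0"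
  obtains c where "c > 0" "\<forall>v\<in>P. h v = c * l v"
proof -
  let ?Z = "\<lambda>l. {v \<in> P. l v = 0}"
  have l: "affine_fun_on I l" "\<forall>v\<in>P. l v \<ge> 0" "is_facet I P (?Z l)"
    using assms(2) unfolding facet_defining_def by auto
  then have "\<exists>v\<in>P. l v \<noteq> 0" unfolding is_facet_def by blast
  then obtain t where t: "t \<ge> 0" "\<forall>v\<in>P. h v - t * l v \<ge> 0" "\<exists>v\<in>P. l v \<noteq> 0 \<and> h v - t * l v = 0"
    using ratio_touch[OF assms(1,4) l(2)] by metis
  let ?h = "\<lambda>v. h v - t * l v"
  have "affine_fun_on I ?h" using affine_fun_on_comb[OF assms(3) l(1), of 1 "- t"] by simp
  then have "is_face I P (?Z ?h)" using t(2) unfolding is_face_def by blast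
  moreover have "?Z l \<subseteq> ?Z ?h" "?Z ?h \<noteq> ?Z l" using assms(5) t(3) by auto
  ultimately have "?Z ?h = P" using l(3) unfolding is_facet_def by blast
  then have eq: "\<forall>v\<in>P. h v = t * l v" by auto
  then have "t \<noteq> 0" using assms(6) by auto
  then have "t > 0" using t(1) by simp
  then show thesis using that eq by blast
qed

text \<open>Call a nonnegative affine function admissible (\<open>H\<close>) if it vanishes where
  \<open>l\<close> does on the face, but not on the whole face. An admissible function with the most
  zeros defines a facet of \<open>P\<close>, and on the face it is proportional to
  \<open>l\<close>.\<close>

lemma facet_defining_extends_from_face:
  assumes "finite P" and g: "affine_fun_on I g" "\<forall>v\<in>P. g v \<ge> 0"
    and l: "facet_defining I {v \<in> P. g v = 0} l"
  obtains L c where "facet_defining I P L" "c > 0" "\<And>v. v \<in> P \<Longrightarrow> g v = 0 \<Longrightarrow> L v = c * l v"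
proof -
  let ?P' = "{v \<in> P. g v = 0}" and ?Z = "\<lambda>l. {v \<in> P. l v = 0}"
  have fl: "affine_fun_on I l" "\<forall>v\<in>?P'. l v \<ge> 0" "is_facet I ?P' {v \<in> ?P'. l v = 0}"
    using l unfolding facet_defining_def by auto
  then obtain w where w: "w \<in> ?P'" "l w \<noteq> 0" unfolding is_facet_def by blast
  define H where "H h \<longleftrightarrow> affine_fun_on I h \<and> (\<forall>v\<in>P. h v \<ge> 0) \<and>
    (\<forall>v\<in>?P'. l v = 0 \<longrightarrow> h v = 0) \<and> (\<exists>v\<in>?P'. h v \<noteq> 0)" for h
  have "\<exists>h. H h"
  proof -
    \<comment> \<open>A large multiple of \<open>g\<close> makes \<open>l\<close> nonnegative on
      \<open>P\<close> and changes nothing on the face, where \<open>g\<close> is zero.\<close>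
    have "\<exists>N. \<forall>v\<in>P. l v + N * g v \<ge> 0"
    proof -
      let ?R = "insert 0 ((\<lambda>v. - l v / g v) ` P)"
      have "l v + Max ?R * g v \<ge> 0" if v: "v \<in> P" for v
      proof (cases "g v = 0")
        case False
        then have "g v > 0" using v g(2) by (metis order_le_less)
        moreover have "- l v / g v \<le> Max ?R" using v assms(1) by (intro Max_ge) auto
        ultimately have "- l v \<le> Max ?R * g v" by (simp only: pos_divide_le_eq)
        then show ?thesis by simp
      qed (use v fl(2) in simp)
      then show ?thesis by blast
    qed
    then obtain N where "\<forall>v\<in>P. l v + N * g v \<ge> 0" by blast
    then have "H (\<lambda>v. l v + N * g v)"
      unfolding H_def using affine_fun_on_comb[OF fl(1) g(1), of 1 N] w by auto
    then show ?thesis by blast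
  qed
  moreover have "\<forall>h. H h \<longrightarrow> card (?Z h) < Suc (card P)"
    using assms(1) by (simp add: card_mono less_Suc_eq_le)
  ultimately obtain h where h: "H h" "\<And>h'. H h' \<Longrightarrow> card (?Z h') \<le> card (?Z h)"
    using ex_has_greatest_nat[of H _ "\<lambda>h. card (?Z h)" "Suc (card P)"] by blast
  have max: "\<not> ?Z h \<subset> ?Z h'" if "H h'" for h'
    using h(2)[OF that] psubset_card_mono[of "?Z h'" "?Z h"] assms(1) by auto
  have "is_facet I P (?Z h)"
    unfolding is_facet_def
  proof (intro conjI allI impI)
    show "is_face I P (?Z h)" using h(1) unfolding H_def is_face_def by blast
    show "?Z h \<noteq> P" using h(1) unfolding H_def by blast
    fix F assume F: "is_face I P F \<and> F \<noteq> P \<and> ?Z h \<subseteq> F"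
    then obtain q where q: "affine_fun_on I q" "\<forall>v\<in>P. q v \<ge> 0" "F = ?Z q"
      unfolding is_face_def by blast
    show "F = ?Z h"
    proof (cases "\<exists>v\<in>?P'. q v \<noteq> 0")
      case True
      then have "H q" using q F h(1) unfolding H_def by blast
      then show ?thesis using max F q(3) by blast
    next
      case False
      \<comment> \<open>Here \<open>q\<close> vanishes on the whole face, so subtracting a multiple
        of it leaves \<open>h\<close> unchanged there. The difference stays admissible and gains a
        zero, against the maximality of \<open>h\<close>.\<close>
      have ne: "\<exists>v\<in>P. q v \<noteq> 0" using F q(3) by blast
      have pos: "\<forall>v\<in>P. h v \<ge> 0" using h(1) unfolding H_def by blast
      obtain t where t: "t \<ge> 0" "\<forall>v\<in>P. h v - t * q v \<ge> 0"
        "\<exists>v\<in>P. q v \<noteq> 0 \<and> h v - t * q v = 0"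
        by (rule ratio_touch[OF assms(1) pos q(2) ne])
      let ?h = "\<lambda>v. h v - t * q v"
      have q0: "q v = 0" if "v \<in> ?P'" for v using False that by blast
      have "affine_fun_on I ?h"
        using affine_fun_on_comb[of I h q 1 "- t"] h(1) q(1) unfolding H_def by simp
      then have "H ?h" using h(1) t(2) q0 unfolding H_def by auto
      moreover have "?Z h \<subset> ?Z ?h" using F q(3) t(3) by auto
      ultimately show ?thesis using max by blast
    qed
  qed
  then have L: "facet_defining I P h" using h(1) unfolding facet_defining_def H_def by blast
  have fin: "finite ?P'" using assms(1) by simp
  have h': "affine_fun_on I h" "\<forall>v\<in>?P'. h v \<ge> 0" "\<exists>v\<in>?P'. h v \<noteq> 0"
    using h(1) unfolding H_def by auto
  have z: "h v = 0" if "v \<in> ?P'" "l v = 0" for v using h(1) that unfolding H_def by blast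
  obtain c where "c > 0" "\<forall>v\<in>?P'. h v = c * l v"
    by (rule facet_functions_proportional[OF fin l h'(1,2) z h'(3)])
  then show thesis using that[OF L] by blast
qed

section \<open>Contractions of biconnected graphs\<close>

lemma induced_edges_iff: "{u, v} \<in> induced_edges E B \<longleftrightarrow> {u, v} \<in> E \<and> u \<in> B \<and> v \<in> B"
  by (auto simp: induced_edges_def)

lemma connected_graph_image:
  assumes "connected_graph A F" "B \<subseteq> h ` A"
    and "\<And>u v. {u, v} \<in> F \<Longrightarrow> h u = h v \<or> {h u, h v} \<in> G"
  shows "connected_graph B G"
proof -
  have "reach G (h u) (h v)" if "{u, v} \<in> F" for u v
    using assms(3)[OF that] by (auto intro: reach_edge)
  then have "reach G (h x) (h y)" if "reach F x y" for x y
    by (rule reach_image[OF that])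
  then have r: "reach G (h x) (h y)" if "x \<in> A" "y \<in> A" for x y
    using assms(1) that unfolding connected_graph_def by simp
  show ?thesis
    unfolding connected_graph_def
  proof (intro ballI)
    fix p q assume "p \<in> B" "q \<in> B"
    then obtain x y where "x \<in> A" "y \<in> A" "p = h x" "q = h y" using assms(2) by blast
    then show "reach G p q" using r by simp
  qed
qed

lemma connected_graph_mono: "connected_graph A F \<Longrightarrow> F \<subseteq> G \<Longrightarrow> connected_graph A G"
  unfolding connected_graph_def using reach_mono by metis

lemma induced_edges_mono: "E \<subseteq> F \<Longrightarrow> A \<subseteq> B \<Longrightarrow> induced_edges E A \<subseteq> induced_edges F B"
  by (auto simp: induced_edges_def)

lemma connected_graph_union:
  assumes "connected_graph B (induced_edges X B)" "connected_graph C (induced_edges X C)"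
    and "x \<in> B" "y \<in> C" "{x, y} \<in> X"
  shows "connected_graph (B \<union> C) (induced_edges X (B \<union> C))"
proof -
  let ?G = "induced_edges X (B \<union> C)"
  have B: "connected_graph B ?G" and C: "connected_graph C ?G"
    using assms(1,2) connected_graph_mono induced_edges_mono by (metis Un_upper1 order_refl, metis Un_upper2 order_refl)
  have xy: "reach ?G x y" using assms(3-5) by (intro reach_edge) (simp add: induced_edges_iff)
  have "reach ?G x z" if "z \<in> B \<union> C" for z
    using that B C assms(3,4) xy reach_trans[OF xy] unfolding connected_graph_def by blast
  then show ?thesis unfolding connected_graph_def by (meson reach_sym reach_trans)
qed

lemma reach_class_connected:
  assumes "G \<subseteq> E"
  shows "connected_graph {z. reach G a z} (induced_edges E {z. reach G a z})"
proof -
  define W where "W = {z. reach G a z}"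
  have "reach (induced_edges E W) a z" if "(\<lambda>x y. {x, y} \<in> G)\<^sup>*\<^sup>* a z" for z
    using that
  proof (induction rule: rtranclp_induct)
    case (step y z)
    then have y: "reach G a y" by (simp add: reach_def)
    then have "reach G a z" using reach_edge[OF step.hyps(2)] by (rule reach_trans)
    then have "{y, z} \<in> induced_edges E W"
      using assms step.hyps(2) y unfolding W_def by (auto simp: induced_edges_iff)
    with step.IH show ?case by (meson reach_edge reach_trans)
  qed simp
  then have r: "reach (induced_edges E W) a z" if "z \<in> W" for z
    using that unfolding W_def by (simp add: reach_def[of G])
  have "connected_graph W (induced_edges E W)"
    unfolding connected_graph_def using r by (meson reach_sym reach_trans)
  then show ?thesis unfolding W_def .
qed

text \<open>Among the pieces that the removal of \<open>v\<close> and a neighbour \<open>u\<close> leaves, a smallest one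
  contains a neighbour of \<open>v\<close> that separates nothing.\<close>

lemma biconnected_noncut_neighbour:
  assumes "finite V" "biconnected V E" "v \<in> V" "card V \<ge> 3"
  obtains u where "u \<in> V" "u \<noteq> v" "{u, v} \<in> E"
    "connected_graph (V - {u, v}) (induced_edges E (V - {u, v}))"
proof -
  let ?D = "\<lambda>S. induced_edges E (V - S)"
  let ?good = "\<lambda>u. u \<in> V \<and> u \<noteq> v \<and> {u, v} \<in> E \<and> connected_graph (V - {u, v}) (?D {u, v})"
  have conn: "connected_graph (V - {w}) (?D {w})" if "w \<in> V" for w
    using assms(2) that unfolding biconnected_def by blast
  have descent: "\<exists>u. ?good u"
    if "u \<in> V" "u \<noteq> v" "C \<noteq> {}" "C \<subseteq> V - {u, v}"
      "\<And>a b. a \<in> C \<Longrightarrow> b \<in> V \<Longrightarrow> {a, b} \<in> E \<Longrightarrow> b \<in> C \<union> {u, v}" for u C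
    using that
  proof (induction "card C" arbitrary: u C rule: less_induct)
    case less
    obtain c where c: "c \<in> C" using less.prems(3) by blast
    \<comment> \<open>Without \<open>u\<close> the graph is still connected, and then
      \<open>C\<close> can be left only towards \<open>v\<close>. Hence \<open>C\<close> contains a
      neighbour \<open>a\<close> of \<open>v\<close>, the next candidate.\<close>
    then have "reach (?D {u}) c v"
      using conn[OF less.prems(1)] less.prems assms(3) unfolding connected_graph_def by blast
    then obtain a b where ab: "a \<in> C" "b \<notin> C" "{a, b} \<in> ?D {u}"
      using reach_leave[of "?D {u}" c v C] c less.prems(4) by blast
    then have "b = v" using less.prems(5)[of a b] by (auto simp: induced_edges_iff)
    then have a: "a \<in> V" "a \<noteq> v" "a \<noteq> u" "{a, v} \<in> E"
      using ab less.prems(4) by (auto simp: induced_edges_iff)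
    let ?G = "?D {a, v}"
    show ?case
    proof (cases "connected_graph (V - {a, v}) ?G")
      case True
      then show ?thesis using a by blast
    next
      case False
      then obtain p q where "p \<in> V - {a, v}" "q \<in> V - {a, v}" "\<not> reach ?G p q"
        unfolding connected_graph_def by blast
      then obtain p where p: "p \<in> V - {a, v}" "\<not> reach ?G p u"
        by (meson reach_sym reach_trans)
      let ?C = "{z. reach ?G p z}"
      have sub: "?C \<subseteq> V - {a, v}"
      proof
        fix z assume "z \<in> ?C"
        then show "z \<in> V - {a, v}"
          using reach_closed[of ?G p z "V - {a, v}"] p by (simp add: induced_edges_iff)
      qed
      \<comment> \<open>Collapsing \<open>C\<close> to \<open>u\<close> turns a path that avoids
        \<open>v\<close> into one that also avoids \<open>a\<close>. So every vertex outside
        \<open>C\<close> other than \<open>v\<close> still reaches \<open>u\<close>, and the piece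
        of \<open>p\<close>, which does not, lies in \<open>C - {a}\<close>.\<close>
      have rest: "reach ?G r u" if "r \<in> V - {v} - C" for r
      proof -
        let ?h = "\<lambda>z. if z \<in> C then u else z"
        have "reach (?D {v}) r u"
          using that less.prems(1,2) conn[OF assms(3)] unfolding connected_graph_def by blast
        moreover have "reach ?G (?h y) (?h z)" if "{y, z} \<in> ?D {v}" for y z
        proof -
          have yz: "{y, z} \<in> E" "{z, y} \<in> E" "y \<in> V - {v}" "z \<in> V - {v}"
            using that by (auto simp: induced_edges_iff insert_commute)
          consider "y \<in> C" "z \<in> C" | "y \<in> C" "z = u" | "z \<in> C" "y = u" | "y \<notin> C" "z \<notin> C"
            using less.prems(5)[of y z] less.prems(5)[of z y] yz by blast
          then show ?thesis
          proof cases
            case 4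
            then have "{y, z} \<in> ?G" using yz ab(1) by (auto simp: induced_edges_iff)
            then show ?thesis using 4 reach_edge by auto
          qed (use less.prems(4) in auto)
        qed
        ultimately have "reach ?G (?h r) (?h u)" by (rule reach_image)
        then show ?thesis using that less.prems(4) by auto
      qed
      have "?C \<subseteq> C - {a}"
      proof
        fix z assume z: "z \<in> ?C"
        then have "\<not> reach ?G z u" using p(2) by (auto intro: reach_trans)
        then show "z \<in> C - {a}" using rest[of z] z sub by blast
      qed
      moreover have "finite C" using less.prems(4) assms(1) finite_subset by blast
      ultimately have "card ?C < card C" using ab(1) by (intro psubset_card_mono) auto
      moreover have "?C \<noteq> {}" using reach_refl[of ?G p] by blast
      moreover have "b \<in> ?C \<union> {a, v}" if "c \<in> ?C" "b \<in> V" "{c, b} \<in> E" for c b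
      proof (rule ccontr)
        assume n: "b \<notin> ?C \<union> {a, v}"
        then have "{c, b} \<in> ?G" using that sub by (auto simp: induced_edges_iff)
        then have "reach ?G p b" using that(1) reach_edge by (metis mem_Collect_eq reach_trans)
        then show False using n by blast
      qed
      ultimately show ?thesis using less.hyps[of ?C a] a(1,2) sub by blast
    qed
  qed
  have "\<not> V \<subseteq> {v}" using assms(1,4) card_mono[of "{v}" V] by auto
  then obtain u where u: "u \<in> V" "u \<noteq> v" by blast
  have "\<not> V \<subseteq> {u, v}"
    using assms(4) card_mono[of "{u, v}" V] card_insert_le_m1[of 2 "{v}" u] by auto
  then have "V - {u, v} \<noteq> {}" by blast
  then have "\<exists>u. ?good u" using descent[of u "V - {u, v}"] u by blast
  then show thesis using that by blast
qed

section \<open>Contracting a biconnected graph onto a set of its vertices\<close>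

definition quotient_edges :: "'a set set \<Rightarrow> ('b \<Rightarrow> 'a set) \<Rightarrow> 'b set \<Rightarrow> 'b set set" where
  "quotient_edges X \<beta> I =
    {{i, j} | i j. i \<in> I \<and> j \<in> I \<and> i \<noteq> j \<and> (\<exists>x\<in>\<beta> i. \<exists>y\<in>\<beta> j. {x, y} \<in> X)}"

lemma quotient_edges_iff:
  "{i, j} \<in> quotient_edges X \<beta> I \<longleftrightarrow> i \<in> I \<and> j \<in> I \<and> i \<noteq> j \<and> (\<exists>x\<in>\<beta> i. \<exists>y\<in>\<beta> j. {x, y} \<in> X)"
  by (auto simp: quotient_edges_def doubleton_eq_iff) (metis insert_commute)+

text \<open>Deleting the merged vertex amounts to deleting both \<open>u\<close> and
  \<open>v\<close>, which is why \<open>u\<close> comes from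
  \<open>biconnected_noncut_neighbour\<close>. Deleting any other vertex gives an image of a
  connected graph under \<open>h\<close>.\<close>

lemma biconnected_contract:
  assumes "finite I" "biconnected I (quotient_edges X \<beta> I)" "v \<in> I" "card I \<ge> 3"
  obtains u where "u \<in> I - {v}" "{u, v} \<in> quotient_edges X \<beta> I"
    "biconnected (I - {v}) (quotient_edges X (\<beta>(u := \<beta> u \<union> \<beta> v)) (I - {v}))"
proof -
  let ?Q = "quotient_edges X \<beta> I"
  obtain u where u: "u \<in> I" "u \<noteq> v" "{u, v} \<in> ?Q"
    "connected_graph (I - {u, v}) (induced_edges ?Q (I - {u, v}))"
    using biconnected_noncut_neighbour[OF assms] by metis
  define Q where "Q = quotient_edges X (\<beta>(u := \<beta> u \<union> \<beta> v)) (I - {v})"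
  define h where "h i = (if i = v then u else i)" for i
  have edge: "h i = h j \<or> {h i, h j} \<in> Q" if "{i, j} \<in> ?Q" for i j
    using that u(1,2) unfolding Q_def h_def quotient_edges_iff by auto
  have "biconnected (I - {v}) Q"
    unfolding biconnected_def
  proof (intro conjI ballI)
    show "card (I - {v}) \<ge> 2" using assms(1,3,4) by simp
    show "connected_graph (I - {v}) Q"
    proof (rule connected_graph_image)
      show "connected_graph I ?Q" using assms(2) unfolding biconnected_def by blast
      show "I - {v} \<subseteq> h ` I" by (auto simp: h_def)
    qed (rule edge)
    fix x assume x: "x \<in> I - {v}"
    show "connected_graph (I - {v} - {x}) (induced_edges Q (I - {v} - {x}))"
    proof (cases "x = u")
      case True
      then have I: "I - {v} - {x} = I - {u, v}" by blast
      show ?thesis unfolding I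
      proof (rule connected_graph_image[OF u(4)])
        show "I - {u, v} \<subseteq> h ` (I - {u, v})" by (auto simp: h_def)
        fix i j assume "{i, j} \<in> induced_edges ?Q (I - {u, v})"
        then show "h i = h j \<or> {h i, h j} \<in> induced_edges Q (I - {u, v})"
          using edge[of i j] by (auto simp: induced_edges_iff h_def)
      qed
    next
      case False
      show ?thesis
      proof (rule connected_graph_image)
        show "connected_graph (I - {x}) (induced_edges ?Q (I - {x}))"
          using assms(2) x unfolding biconnected_def by blast
        show "I - {v} - {x} \<subseteq> h ` (I - {x})" by (auto simp: h_def)
        fix i j assume "{i, j} \<in> induced_edges ?Q (I - {x})"
        then show "h i = h j \<or> {h i, h j} \<in> induced_edges Q (I - {v} - {x})"
          using edge[of i j] False u(1,2) by (auto simp: induced_edges_iff h_def)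
      qed
    qed
  qed
  then show thesis using that u unfolding Q_def by blast
qed

text \<open>Vertices outside \<open>A\<close> are merged into neighbours one at a time;
  \<open>card A \<ge> 2\<close> leaves at least three vertices before each merge. Branch sets only
  grow, so \<open>\<gamma> i\<close> keeps whatever was attached at
  \<open>\<beta> i\<close>.\<close>

lemma biconnected_contract_onto:
  fixes \<beta> :: "'b \<Rightarrow> 'a set"
  assumes "finite I" "biconnected I (quotient_edges X \<beta> I)" "A \<subseteq> I" "card A \<ge> 2"
    and "\<And>i. i \<in> I \<Longrightarrow> \<beta> i \<subseteq> U \<and> connected_graph (\<beta> i) (induced_edges X (\<beta> i))"
    and "\<And>i j. i \<in> I \<Longrightarrow> j \<in> I \<Longrightarrow> i \<noteq> j \<Longrightarrow> \<beta> i \<inter> \<beta> j = {}"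
  shows "\<exists>\<gamma>. biconnected A (quotient_edges X \<gamma> A)
    \<and> (\<forall>i\<in>A. \<beta> i \<subseteq> \<gamma> i \<and> \<gamma> i \<subseteq> U \<and> connected_graph (\<gamma> i) (induced_edges X (\<gamma> i)))
    \<and> (\<forall>i\<in>A. \<forall>j\<in>A. i \<noteq> j \<longrightarrow> \<gamma> i \<inter> \<gamma> j = {})"
  using assms
proof (induction "card I" arbitrary: I \<beta>)
  case 0
  then show ?case by simp
next
  case (Suc n)
  show ?case
  proof (cases "A = I")
    case True
    then show ?thesis using Suc.prems by (intro exI[of _ \<beta>]) auto
  next
    case False
    then obtain v where v: "v \<in> I" "v \<notin> A" using Suc.prems(3) by blast
    then have "card A < card I" using Suc.prems(1,3) by (intro psubset_card_mono) auto
    then have "card I \<ge> 3" using Suc.prems(4) by simp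
    then obtain u where u: "u \<in> I - {v}" "{u, v} \<in> quotient_edges X \<beta> I"
      "biconnected (I - {v}) (quotient_edges X (\<beta>(u := \<beta> u \<union> \<beta> v)) (I - {v}))"
      using biconnected_contract Suc.prems(1,2) v(1) by metis
    let ?\<beta> = "\<beta>(u := \<beta> u \<union> \<beta> v)"
    have "connected_graph (\<beta> u \<union> \<beta> v) (induced_edges X (\<beta> u \<union> \<beta> v))"
      using u(1,2) v(1) Suc.prems(5) unfolding quotient_edges_iff
      by (blast intro: connected_graph_union)
    then have c: "?\<beta> i \<subseteq> U \<and> connected_graph (?\<beta> i) (induced_edges X (?\<beta> i))" if "i \<in> I - {v}" for i
      using that Suc.prems(5) v(1) u(1) by auto
    have d: "?\<beta> i \<inter> ?\<beta> j = {}" if "i \<in> I - {v}" "j \<in> I - {v}" "i \<noteq> j" for i j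
      using that Suc.prems(6) v(1) u(1) by (auto simp: Int_Un_distrib Int_Un_distrib2)
    have "n = card (I - {v})" "finite (I - {v})" "A \<subseteq> I - {v}"
      using Suc.hyps(2) Suc.prems(1,3) v by auto
    then obtain \<gamma> where \<gamma>: "biconnected A (quotient_edges X \<gamma> A)"
      "\<forall>i\<in>A. ?\<beta> i \<subseteq> \<gamma> i \<and> \<gamma> i \<subseteq> U \<and> connected_graph (\<gamma> i) (induced_edges X (\<gamma> i))"
      "\<forall>i\<in>A. \<forall>j\<in>A. i \<noteq> j \<longrightarrow> \<gamma> i \<inter> \<gamma> j = {}"
      using Suc.hyps(1)[OF _ _ u(3) _ Suc.prems(4) c d] by blast
    moreover have "\<beta> i \<subseteq> ?\<beta> i" for i by auto
    ultimately show ?thesis by (intro exI[of _ \<gamma>]) (meson order_trans)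
  qed
qed

lemma minimally_biconnected_subgraph:
  assumes "finite E" "biconnected V E"
  obtains F where "F \<subseteq> E" "minimally_biconnected V F"
proof -
  have "\<exists>F\<subseteq>E. minimally_biconnected V F"
    using assms
  proof (induction "card E" arbitrary: E rule: less_induct)
    case less
    show ?case
    proof (cases "minimally_biconnected V E")
      case False
      then obtain e where "e \<in> E" "biconnected V (E - {e})"
        using less.prems(2) unfolding minimally_biconnected_def by blast
      then show ?thesis
        using less.hyps[of "E - {e}"] less.prems(1) card_Diff1_less[of E e] by blast
    qed blast
  qed
  then show thesis using that by blast
qed

section \<open>Cone minors from a connected set attached to a biconnected subgraph\<close>

abbreviation (input) has_cone_minor :: "nat \<Rightarrow> 'a set \<Rightarrow> 'a set set \<Rightarrow> bool" where
  "has_cone_minor k V E \<equiv> (\<exists>(VH :: nat set) (EH :: nat set set).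
     graph VH EH \<and> card VH = k + 1 \<and> minimally_biconnected VH EH \<and>
     is_minor (cone_vertices VH) (cone_edges VH EH) V E)"

text \<open>\<open>W\<close> becomes the branch set of the apex. Contracting \<open>(U, X)\<close>
  onto \<open>N\<close> puts one attachment into each of the other branch sets, which supplies the
  spokes.\<close>

lemma cone_minor_if_attached:
  assumes "X \<subseteq> E" "finite U" "U \<subseteq> V" "\<Union>X \<subseteq> U" "biconnected U X"
    and W: "W \<noteq> {}" "W \<subseteq> V" "W \<inter> U = {}" "connected_graph W (induced_edges E W)"
    and N: "N \<subseteq> U" "card N = k + 1" "k \<ge> 1" "\<And>n. n \<in> N \<Longrightarrow> \<exists>w\<in>W. {n, w} \<in> E"
  shows "has_cone_minor k V E"
proof -
  \<comment> \<open>The base of the cone has to be a graph on natural numbers, so \<open>U\<close>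
    is numbered by \<open>g\<close>, with inverse \<open>r\<close>, and its edges are carried over
    to the indices.\<close>
  obtain g where g: "bij_betw g {0..<card U} U" using ex_bij_betw_nat_finite[OF assms(2)] by blast
  define I where "I = {0..<card U}"
  define r where "r = inv_into I g"
  have g: "bij_betw g I U" using g I_def by simp
  have gr: "r x \<in> I" "g (r x) = x" if "x \<in> U" for x
    using that g unfolding r_def bij_betw_def by (auto intro: inv_into_into f_inv_into_f)
  have rg: "r (g i) = i" "g i \<in> U" if "i \<in> I" for i
    using that g unfolding r_def bij_betw_def by auto
  define \<beta> where "\<beta> i = {g i}" for i
  let ?Q = "quotient_edges X \<beta> I"
  have edge: "r x = r y \<or> {r x, r y} \<in> induced_edges ?Q (r ` S)"
    if "{x, y} \<in> induced_edges X S" "S \<subseteq> U" for x y S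
  proof -
    have "{x, y} \<in> X" "x \<in> S" "y \<in> S" "x \<in> U" "y \<in> U"
      using that by (auto simp: induced_edges_iff)
    then show ?thesis
      using gr[of x] gr[of y] unfolding induced_edges_iff quotient_edges_iff \<beta>_def by auto
  qed
  have rU: "I - Y = r ` (U - g ` Y)" if "Y \<subseteq> I" for Y
  proof
    show "I - Y \<subseteq> r ` (U - g ` Y)"
    proof
      fix i assume i: "i \<in> I - Y"
      then have "g i \<notin> g ` Y" using that rg(1) by (metis Diff_iff imageE subsetD)
      then show "i \<in> r ` (U - g ` Y)" using i rg[of i] by force
    qed
    show "r ` (U - g ` Y) \<subseteq> I - Y" using gr by force
  qed
  have conn: "connected_graph (I - Y) (induced_edges ?Q (I - Y))"
    if "Y \<subseteq> I" "connected_graph (U - g ` Y) (induced_edges X (U - g ` Y))" for Y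
    unfolding rU[OF that(1)]
    by (rule connected_graph_image[OF that(2) order_refl]) (use edge in blast)
  have bi: "biconnected I ?Q"
    unfolding biconnected_def
  proof (intro conjI ballI)
    show "card I \<ge> 2" using assms(5) unfolding biconnected_def I_def by simp
    have "induced_edges X U = X" using assms(4) unfolding induced_edges_def by blast
    then show "connected_graph I ?Q"
      using conn[of "{}"] assms(5) connected_graph_mono[of I "induced_edges ?Q I" ?Q]
      unfolding biconnected_def by (simp add: induced_edges_def)
    fix i assume "i \<in> I"
    then show "connected_graph (I - {i}) (induced_edges ?Q (I - {i}))"
      using conn[of "{i}"] assms(5) rg(2) unfolding biconnected_def by simp
  qed
  define A where "A = r ` N"
  have A: "A \<subseteq> I" "card A = k + 1"
  proof -
    show "A \<subseteq> I" using gr N(1) unfolding A_def by blast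
    have "inj_on r N" using gr(2) N(1) by (metis inj_onI subsetD)
    then show "card A = k + 1" using N(2) card_image unfolding A_def by metis
  qed
  have fin: "finite I" unfolding I_def by simp
  have A2: "card A \<ge> 2" using A(2) N(3) by simp
  have b: "\<beta> i \<subseteq> U \<and> connected_graph (\<beta> i) (induced_edges X (\<beta> i))" if "i \<in> I" for i
    using rg(2)[OF that] unfolding \<beta>_def connected_graph_def by simp
  have d: "\<beta> i \<inter> \<beta> j = {}" if "i \<in> I" "j \<in> I" "i \<noteq> j" for i j
    using rg(1)[OF that(1)] rg(1)[OF that(2)] that(3) unfolding \<beta>_def by auto
  have "\<exists>\<gamma>. biconnected A (quotient_edges X \<gamma> A)
    \<and> (\<forall>i\<in>A. \<beta> i \<subseteq> \<gamma> i \<and> \<gamma> i \<subseteq> U \<and> connected_graph (\<gamma> i) (induced_edges X (\<gamma> i)))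
    \<and> (\<forall>i\<in>A. \<forall>j\<in>A. i \<noteq> j \<longrightarrow> \<gamma> i \<inter> \<gamma> j = {})"
    by (rule biconnected_contract_onto[OF fin bi A(1) A2 b d])
  then obtain \<gamma> where \<gamma>: "biconnected A (quotient_edges X \<gamma> A)"
    "\<And>i. i \<in> A \<Longrightarrow> \<beta> i \<subseteq> \<gamma> i \<and> \<gamma> i \<subseteq> U \<and> connected_graph (\<gamma> i) (induced_edges X (\<gamma> i))"
    "\<And>i j. i \<in> A \<Longrightarrow> j \<in> A \<Longrightarrow> i \<noteq> j \<Longrightarrow> \<gamma> i \<inter> \<gamma> j = {}"
    by auto
  have "finite A" using A fin finite_subset by blast
  moreover have "quotient_edges X \<gamma> A \<subseteq> Pow A" unfolding quotient_edges_def by auto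
  ultimately have "finite (quotient_edges X \<gamma> A)" using finite_subset by blast
  then obtain F where F: "F \<subseteq> quotient_edges X \<gamma> A" "minimally_biconnected A F"
    using minimally_biconnected_subgraph \<gamma>(1) by metis
  have Fq: "i \<in> A \<and> j \<in> A \<and> i \<noteq> j \<and> (\<exists>x\<in>\<gamma> i. \<exists>y\<in>\<gamma> j. {x, y} \<in> X)" if "{i, j} \<in> F" for i j
    using that F(1) quotient_edges_iff[of i j X \<gamma> A] by blast
  have "graph A F"
    using F(1) \<open>finite A\<close> unfolding graph_def quotient_edges_def by blast
  moreover have "is_minor (cone_vertices A) (cone_edges A F) V E"
  proof -
    define \<delta> where "\<delta> = case_option W \<gamma>"
    have \<delta>: "\<delta> None = W" "\<delta> (Some i) = \<gamma> i" for i by (simp_all add: \<delta>_def)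
    have attach: "\<exists>x\<in>W. \<exists>y\<in>\<gamma> i. {x, y} \<in> E" if i: "i \<in> A" for i
    proof -
      obtain n where n: "n \<in> N" "i = r n" using i unfolding A_def by blast
      then have "n \<in> \<gamma> i" using \<gamma>(2)[OF i] gr(2)[of n] N(1) unfolding \<beta>_def by auto
      then show ?thesis using N(4)[OF n(1)] by (metis insert_commute)
    qed
    have "\<forall>v\<in>cone_vertices A. \<delta> v \<noteq> {} \<and> \<delta> v \<subseteq> V \<and>
        connected_graph (\<delta> v) (induced_edges E (\<delta> v))"
    proof
      fix v assume v: "v \<in> cone_vertices A"
      show "\<delta> v \<noteq> {} \<and> \<delta> v \<subseteq> V \<and> connected_graph (\<delta> v) (induced_edges E (\<delta> v))"
      proof (cases v)
        case None
        then show ?thesis using W \<delta> by simp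
      next
        case (Some i)
        then have i: "i \<in> A" using v unfolding cone_vertices_def by auto
        then have "connected_graph (\<gamma> i) (induced_edges E (\<gamma> i))"
          using \<gamma>(2) connected_graph_mono induced_edges_mono[OF assms(1) order_refl] by metis
        moreover have "\<gamma> i \<noteq> {}" using \<gamma>(2)[OF i] unfolding \<beta>_def by blast
        ultimately show ?thesis using \<gamma>(2)[OF i] assms(3) Some \<delta> by auto
      qed
    qed
    moreover have "\<forall>u\<in>cone_vertices A. \<forall>v\<in>cone_vertices A. u \<noteq> v \<longrightarrow> \<delta> u \<inter> \<delta> v = {}"
      using \<gamma>(2,3) W(3) unfolding cone_vertices_def by (auto simp: \<delta>) blast+
    moreover have "\<forall>u v. {u, v} \<in> cone_edges A F \<longrightarrow> (\<exists>x\<in>\<delta> u. \<exists>y\<in>\<delta> v. {x, y} \<in> E)"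
    proof (intro allI impI)
      fix u v assume "{u, v} \<in> cone_edges A F"
      then consider (base) e where "e \<in> F" "{u, v} = Some ` e"
        | (apex) i where "i \<in> A" "{u, v} = {None, Some i}"
        unfolding cone_edges_def by blast
      then show "\<exists>x\<in>\<delta> u. \<exists>y\<in>\<delta> v. {x, y} \<in> E"
      proof cases
        case base
        then obtain i j where ij: "u = Some i" "v = Some j" by (metis imageE insertCI)
        then have "Some ` e = Some ` {i, j}" using base by simp
        then have "e = {i, j}" by (metis inj_Some inj_image_eq_iff)
        then show ?thesis using Fq[of i j] base(1) ij assms(1) \<delta> by (metis subsetD)
      next
        case apex
        then show ?thesis
          using attach[OF apex(1)] \<delta> by (auto simp: doubleton_eq_iff) (metis insert_commute)
      qed
    qed
    ultimately show ?thesis unfolding is_minor_def by blast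
  qed
  ultimately show ?thesis using A(2) F(2) by blast
qed

text \<open>The cone over a single edge is a triangle. A second connection from \<open>u\<close> to
  \<open>v\<close> runs through a component \<open>W\<close> of the graph without \<open>u\<close>
  and \<open>v\<close>, and this component is attached to both.\<close>

lemma triangle_minor_if_cycle:
  assumes "graph V E" "{u, v} \<in> E" "reach (E - {{u, v}}) u v"
  shows "has_cone_minor 1 V E"
proof -
  interpret finite_graph V E by unfold_locales (rule assms(1))
  have uv: "u \<noteq> v" "u \<in> V" "v \<in> V" using edge_pair[OF assms(2)] by auto
  let ?Gv = "induced_edges E (V - {v})" and ?G = "induced_edges E (V - {u, v})"
  have avoid: "reach ?Gv u z \<Longrightarrow> z \<noteq> v" for z
    using reach_closed[of ?Gv u z "V - {v}"] uv by (auto simp: induced_edges_iff)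
  then obtain a b where ab: "reach ?Gv u a" "\<not> reach ?Gv u b" "{a, b} \<in> E - {{u, v}}"
    using reach_leave[OF assms(3), of "{z. reach ?Gv u z}"] by auto
  have "b = v"
  proof (rule ccontr)
    assume "b \<noteq> v"
    then have "{a, b} \<in> ?Gv" using ab edge_pair[of a b] avoid[OF ab(1)] by (auto simp: induced_edges_iff)
    then show False using ab(1,2) reach_edge reach_trans by metis
  qed
  then have a: "{a, v} \<in> E" "a \<noteq> u" "a \<noteq> v" "a \<in> V" using ab(3) edge_pair by auto
  define W where "W = {z. reach ?G a z}"
  have "a \<in> W" unfolding W_def by simp
  have sub: "W \<subseteq> V - {u, v}"
  proof
    fix z assume "z \<in> W"
    then show "z \<in> V - {u, v}"
      using reach_closed[of ?G a z "V - {u, v}"] a uv unfolding W_def by (auto simp: induced_edges_iff)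
  qed
  have "\<exists>w\<in>W. {u, w} \<in> E"
  proof -
    obtain c d where cd: "c \<in> W" "d \<notin> W" "{c, d} \<in> ?Gv"
      using reach_leave[OF reach_sym[OF ab(1)] \<open>a \<in> W\<close>] sub by blast
    have "d = u"
    proof (rule ccontr)
      assume "d \<noteq> u"
      then have "{c, d} \<in> ?G" using cd sub by (auto simp: induced_edges_iff)
      then have "reach ?G a d" using cd(1) reach_edge unfolding W_def by (metis mem_Collect_eq reach_trans)
      then show False using cd(2) unfolding W_def by simp
    qed
    then show ?thesis using cd by (auto simp: induced_edges_iff insert_commute)
  qed
  then have att: "\<exists>w\<in>W. {n, w} \<in> E" if "n \<in> {u, v}" for n
    using that a(1) \<open>a \<in> W\<close> by (auto simp: insert_commute)
  have "connected_graph W (induced_edges E W)"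
    unfolding W_def by (rule reach_class_connected) (auto simp: induced_edges_def)
  moreover have "biconnected {u, v} {{u, v}}"
  proof -
    have "reach {{u, v}} u v" "reach {{u, v}} v u" by (rule reach_edge; auto)+
    moreover have "{u, v} - {u} = {v}" "{u, v} - {v} = {u}" using uv(1) by auto
    ultimately show ?thesis using uv(1) unfolding biconnected_def connected_graph_def by auto
  qed
  ultimately show ?thesis
    using cone_minor_if_attached[of "{{u, v}}" E "{u, v}" V W "{u, v}" 1]
      assms(2) uv \<open>a \<in> W\<close> sub att by auto
qed

section \<open>A cone minor yields a facet with many values\<close>

definition ind :: "'i set \<Rightarrow> 'i \<Rightarrow> real" where
  "ind T = (\<lambda>e. if e \<in> T then 1 else 0)"

lemma base_config_eq: "base_config E = ind ` {T. spanning_forest E T}"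
  unfolding base_config_def ind_def by blast

lemma sum_ind:
  assumes "finite I" "T \<subseteq> I"
  shows "(\<Sum>i\<in>I. a i * ind T i) = sum a T"
proof -
  have "(\<Sum>i\<in>I. a i * ind T i) = (\<Sum>i\<in>I. if i \<in> T then a i else 0)"
    by (rule sum.cong) (auto simp: ind_def)
  also have "\<dots> = sum a (I \<inter> T)" using assms(1) by (simp add: sum.inter_restrict)
  finally show ?thesis using assms(2) by (simp add: Int_absorb1)
qed

lemma sum_indicator: "finite T \<Longrightarrow> (\<Sum>e\<in>T. if e \<in> A then 1 else 0 :: real) = card (T \<inter> A)"
  by (simp add: sum.inter_restrict[symmetric])

lemma affine_fun_on_linear: "affine_fun_on I (\<lambda>x. c + (\<Sum>i\<in>I. a i * x i))"
  unfolding affine_fun_on_def by blast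

lemma (in finite_graph) finite_base_config: "finite (base_config E)"
proof -
  have "{T. spanning_forest E T} \<subseteq> Pow E" unfolding spanning_forest_def by blast
  then show ?thesis unfolding base_config_eq using finite_E finite_subset by blast
qed

text \<open>A minor model of the cone over \<open>(I, H)\<close> with the branch set
  \<open>W\<close> of the apex singled out. \<open>E\<close> may contain further edges between the
  sets \<open>B i\<close>; the arguments below allow for them.\<close>

locale cone_model = finite_graph V E for V :: "'a set" and E +
  fixes B :: "'b \<Rightarrow> 'a set" and W :: "'a set" and I :: "'b set" and H :: "'b set set" and k :: nat
  assumes graph_H: "graph I H" and biconnected_H: "biconnected I H" and card_I: "card I = k + 1"
    and B_ne: "i \<in> I \<Longrightarrow> B i \<noteq> {}"
    and B_connected: "i \<in> I \<Longrightarrow> connected_graph (B i) (induced_edges E (B i))"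
    and B_disjoint: "i \<in> I \<Longrightarrow> j \<in> I \<Longrightarrow> i \<noteq> j \<Longrightarrow> B i \<inter> B j = {}"
    and W_connected: "connected_graph W (induced_edges E W)"
    and W_disjoint: "i \<in> I \<Longrightarrow> W \<inter> B i = {}"
    and H_edge: "{i, j} \<in> H \<Longrightarrow> \<exists>x\<in>B i. \<exists>y\<in>B j. {x, y} \<in> E"
    and star_edge: "i \<in> I \<Longrightarrow> \<exists>x\<in>W. \<exists>y\<in>B i. {x, y} \<in> E"
begin

lemma finite_I: "finite I"
  using graph_H by (simp add: graph_def)

lemma k_pos: "k \<ge> 1"
  using biconnected_H card_I by (simp add: biconnected_def)

lemma B_unique: "x \<in> B i \<Longrightarrow> x \<in> B j \<Longrightarrow> i \<in> I \<Longrightarrow> j \<in> I \<Longrightarrow> i = j"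
  using B_disjoint by blast

lemma H_pair: "{i, j} \<in> H \<Longrightarrow> i \<noteq> j \<and> i \<in> I \<and> j \<in> I"
  using graph_H finite_graph.edge_pair[of I H] finite_graph.intro by blast

text \<open>Once the edges in \<open>C0\<close> are contracted, \<open>F\<close> is the base of the
  cone and \<open>S\<close> consists of its spokes. The forest \<open>C\<close> realises this
  contraction inside the branch sets.\<close>

definition C0 where "C0 = {e \<in> E. e \<subseteq> W \<or> (\<exists>i\<in>I. e \<subseteq> B i)}"
definition F where "F = {{x, y} | x y. {x, y} \<in> E \<and> (\<exists>i\<in>I. \<exists>j\<in>I. i \<noteq> j \<and> x \<in> B i \<and> y \<in> B j)}"
definition S where "S = {{x, y} | x y. {x, y} \<in> E \<and> x \<in> W \<and> (\<exists>i\<in>I. y \<in> B i)}"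
definition M where "M = W \<union> (\<Union>i\<in>I. B i)"
definition C where "C = (SOME C. C \<subseteq> C0 \<and> forest C \<and> spans C0 C)"

lemma F_I: "{x, y} \<in> E \<Longrightarrow> i \<in> I \<Longrightarrow> j \<in> I \<Longrightarrow> i \<noteq> j \<Longrightarrow> x \<in> B i \<Longrightarrow> y \<in> B j \<Longrightarrow> {x, y} \<in> F"
  unfolding F_def by blast

lemma F_E:
  assumes "e \<in> F"
  obtains x y i j where "e = {x, y}" "i \<in> I" "j \<in> I" "i \<noteq> j" "x \<in> B i" "y \<in> B j"
  using assms unfolding F_def by blast

lemma S_I: "{x, y} \<in> E \<Longrightarrow> x \<in> W \<Longrightarrow> i \<in> I \<Longrightarrow> y \<in> B i \<Longrightarrow> {x, y} \<in> S"
  unfolding S_def by blast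

lemma S_E:
  assumes "e \<in> S"
  obtains x y i where "e = {x, y}" "i \<in> I" "x \<in> W" "y \<in> B i"
  using assms unfolding S_def by blast

lemma C: "C \<subseteq> C0" "forest C" "spans C0 C"
proof -
  have "C0 \<subseteq> E" unfolding C0_def by blast
  then have "\<exists>C. C \<subseteq> C0 \<and> forest C \<and> spans C0 C"
    using extend_forest[OF forest_empty empty_subsetI] by metis
  then show "C \<subseteq> C0" "forest C" "spans C0 C" unfolding C_def by (metis (mono_tags, lifting) someI_ex)+
qed

lemma sub_E: "C0 \<subseteq> E" "F \<subseteq> E" "S \<subseteq> E" "C \<subseteq> E"
  using C(1) unfolding C0_def F_def S_def by blast+

lemma C0_step:
  assumes "{x, y} \<in> C0" "x \<in> B i" "i \<in> I"
  shows "y \<in> B i"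
proof -
  have "x \<notin> W" using W_disjoint[OF assms(3)] assms(2) by blast
  then obtain j where j: "j \<in> I" "x \<in> B j" "y \<in> B j" using assms(1) unfolding C0_def by auto
  then have "j = i" using B_unique assms(2,3) by metis
  then show ?thesis using j by simp
qed

lemma disjoint: "F \<inter> C0 = {}" "S \<inter> C0 = {}" "F \<inter> S = {}"
proof -
  have "{x, y} \<notin> C0" if "i \<in> I" "j \<in> I" "i \<noteq> j" "x \<in> B i" "y \<in> B j" for i j x y
    using C0_step that B_unique by metis
  then show "F \<inter> C0 = {}" unfolding F_def by blast
  have "{x, y} \<notin> C0" if "i \<in> I" "x \<in> W" "y \<in> B i" for i x y
    using C0_step[of y x i] that W_disjoint by (auto simp: insert_commute)
  then show "S \<inter> C0 = {}" unfolding S_def by blast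
  have "e \<inter> W = {}" if "e \<in> F" for e using that W_disjoint unfolding F_def by blast
  moreover have "e \<inter> W \<noteq> {}" if "e \<in> S" for e using that unfolding S_def by blast
  ultimately show "F \<inter> S = {}" by blast
qed

lemma disjoint_C: "F \<inter> C = {}" "S \<inter> C = {}"
  using disjoint C(1) by blast+

lemma FS_in_M: "e \<in> F \<union> S \<Longrightarrow> \<exists>x\<in>M. \<exists>y\<in>M. e = {x, y}"
  unfolding F_def S_def M_def by blast

lemma reach_part:
  assumes "connected_graph A (induced_edges E A)" "induced_edges E A \<subseteq> C0" "x \<in> A" "y \<in> A" "C \<subseteq> T"
  shows "reach T x y"
proof -
  have "reach C0 x y" using assms(1-4) reach_mono unfolding connected_graph_def by metis
  then show ?thesis using spans_reach[OF C(3)] assms(5) reach_mono by metis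
qed

lemma reach_B: "i \<in> I \<Longrightarrow> x \<in> B i \<Longrightarrow> y \<in> B i \<Longrightarrow> C \<subseteq> T \<Longrightarrow> reach T x y"
  by (rule reach_part[OF B_connected]) (auto simp: C0_def induced_edges_def)

lemma reach_W: "x \<in> W \<Longrightarrow> y \<in> W \<Longrightarrow> C \<subseteq> T \<Longrightarrow> reach T x y"
  by (rule reach_part[OF W_connected]) (auto simp: C0_def induced_edges_def)

lemma hub:
  assumes "C \<subseteq> T" "\<And>i. i \<in> I \<Longrightarrow> \<exists>x\<in>W. \<exists>y\<in>B i. reach T x y" "x \<in> M" "y \<in> M"
  shows "reach T x y"
proof -
  have "\<exists>w\<in>W. reach T w x" if x: "x \<in> M" for x
  proof (cases "x \<in> W")
    case False
    then obtain i where i: "i \<in> I" "x \<in> B i" using x unfolding M_def by blast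
    then obtain w y where "w \<in> W" "y \<in> B i" "reach T w y" using assms(2) by blast
    then show ?thesis using reach_B[OF i(1) _ i(2) assms(1)] reach_trans by metis
  next
    case True
    then show ?thesis by (intro bexI[of _ x]) simp_all
  qed
  then obtain w w' where "w \<in> W" "w' \<in> W" "reach T w x" "reach T w' y" using assms(3,4) by metis
  moreover from this have "reach T w w'" using reach_W assms(1) by blast
  ultimately show ?thesis by (meson reach_sym reach_trans)
qed

definition FJ where "FJ J = {e \<in> F. e \<subseteq> (\<Union>j\<in>J. B j)}"

text \<open>\<open>X\<close> lifts a spanning tree of \<open>H\<close> on \<open>J\<close>. Its size
  is found by comparison: \<open>T\<close> is spanned by \<open>C\<close> and the star
  \<open>D\<close>, whose \<open>card J - 1\<close> pairs join chosen representatives and may lie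
  outside \<open>E\<close>.\<close>

lemma tree:
  assumes J: "J \<subseteq> I" "J \<noteq> {}" "connected_graph J (induced_edges H J)"
  obtains X where "X \<subseteq> FJ J" "card X \<le> card J - 1"
    "\<And>i j x y. i \<in> J \<Longrightarrow> j \<in> J \<Longrightarrow> x \<in> B i \<Longrightarrow> y \<in> B j \<Longrightarrow> reach (C \<union> X) x y"
proof -
  have "C \<union> FJ J \<subseteq> E" using sub_E unfolding FJ_def by blast
  then obtain T where T: "C \<subseteq> T" "T \<subseteq> C \<union> FJ J" "forest T" "spans (C \<union> FJ J) T"
    using extend_forest[OF C(2) Un_upper1] by metis
  have TE: "T \<subseteq> E" using T(2) \<open>C \<union> FJ J \<subseteq> E\<close> by blast
  define X where "X = T - C"
  have CX: "C \<union> X = T" using T(1) unfolding X_def by blast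
  have adj: "\<exists>x\<in>B i. \<exists>y\<in>B j. reach T x y" if ij: "{i, j} \<in> induced_edges H J" for i j
  proof -
    have "{i, j} \<in> H" "i \<in> J" "j \<in> J" using ij by (auto simp: induced_edges_iff)
    then obtain x y where xy: "x \<in> B i" "y \<in> B j" "{x, y} \<in> E" using H_edge by blast
    then have "{x, y} \<in> F" using H_pair[OF \<open>{i, j} \<in> H\<close>] F_I by metis
    then have "{x, y} \<in> FJ J" using \<open>i \<in> J\<close> \<open>j \<in> J\<close> xy(1,2) unfolding FJ_def by auto
    then show ?thesis using xy spansD[OF T(4)] by blast
  qed
  have conn: "\<forall>x\<in>B i. \<forall>y\<in>B j. reach T x y"
    if "(\<lambda>x y. {x, y} \<in> induced_edges H J)\<^sup>*\<^sup>* i j" "i \<in> I" for i j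
    using that
  proof (induction rule: rtranclp_induct)
    case base
    then show ?case using reach_B T(1) by blast
  next
    case (step j l)
    then obtain y z where yz: "y \<in> B j" "z \<in> B l" "reach T y z" using adj by blast
    have "l \<in> I" using step.hyps(2) J(1) by (auto simp: induced_edges_iff)
    then have "reach T z u" if "u \<in> B l" for u using reach_B yz(2) that T(1) by blast
    then show ?case using step.IH step.prems yz(1,3) by (meson reach_trans)
  qed
  have all: "reach T x y" if "i \<in> J" "j \<in> J" "x \<in> B i" "y \<in> B j" for i j x y
    using conn[of i j] that J(1,3) unfolding connected_graph_def reach_def by blast
  obtain r where r: "r \<in> J" using J(2) by blast
  define b where "b j = (SOME x. x \<in> B j)" for j
  have b: "b j \<in> B j" if "j \<in> I" for j using B_ne[OF that] unfolding b_def by (simp add: some_in_eq)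
  define D where "D = (\<lambda>j. {b r, b j}) ` (J - {r})"
  have finJ: "finite J" using J(1) finite_I finite_subset by blast
  have toroot: "reach (C \<union> D) x (b r)" if "j \<in> J" "x \<in> B j" for j x
  proof -
    have "reach (C \<union> D) x (b j)" using reach_B[of j x "b j" "C \<union> D"] that b J(1) by blast
    moreover have "reach (C \<union> D) (b j) (b r)"
    proof (cases "j = r")
      case False
      then have "{b j, b r} \<in> C \<union> D" using that unfolding D_def by (auto simp: insert_commute)
      then show ?thesis by (rule reach_edge)
    qed simp
    ultimately show ?thesis by (rule reach_trans)
  qed
  have "reach (C \<union> D) x y" if xy: "{x, y} \<in> T" for x y
  proof (cases "{x, y} \<in> C")
    case True
    then show ?thesis by (intro reach_edge) blast
  next
    case False
    then have "{x, y} \<in> FJ J" using xy T(2) by blast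
    then obtain i j where "i \<in> J" "j \<in> J" "x \<in> B i" "y \<in> B j" unfolding FJ_def by auto
    then show ?thesis using toroot by (meson reach_sym reach_trans)
  qed
  then have "spans T (C \<union> D)" unfolding spans_def by blast
  moreover have "finite (C \<union> D)" using finJ finite_edges sub_E(4) unfolding D_def by blast
  ultimately have "card T \<le> card (C \<union> D)" using card_le[OF TE T(3)] by blast
  also have "\<dots> \<le> card C + card (J - {r})"
    using card_Un_le[of C D] card_image_le[of "J - {r}" "\<lambda>j. {b r, b j}"] finJ unfolding D_def by simp
  finally have "card X \<le> card J - 1"
    using r finJ T(1) finite_edges[OF TE] finite_edges[OF sub_E(4)]
    unfolding X_def by (simp add: card_Diff_subset)
  moreover have "X \<subseteq> FJ J" using T(2) unfolding X_def by blast
  ultimately show thesis using that[of X] all unfolding CX by blast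
qed

definition s where "s i = (SOME e. e \<in> E \<and> (\<exists>x\<in>W. \<exists>y\<in>B i. e = {x, y}))"

lemma s: "i \<in> I \<Longrightarrow> s i \<in> S \<and> (\<exists>x\<in>W. \<exists>y\<in>B i. s i = {x, y})"
proof -
  assume i: "i \<in> I"
  then have "\<exists>e. e \<in> E \<and> (\<exists>x\<in>W. \<exists>y\<in>B i. e = {x, y})" using star_edge[OF i] by blast
  then have "s i \<in> E \<and> (\<exists>x\<in>W. \<exists>y\<in>B i. s i = {x, y})" unfolding s_def by (rule someI_ex)
  then show ?thesis using i S_I by metis
qed

lemma s_B: "i \<in> I \<Longrightarrow> j \<in> I \<Longrightarrow> s i \<inter> B j \<noteq> {} \<longleftrightarrow> i = j"
  using s[of i] W_disjoint[of j] B_disjoint[of i j] by fastforce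

lemma inj_s: "inj_on s I"
  using s_B by (metis inj_onI)

text \<open>As long as the spoke \<open>s j\<close> is missing, no edge present leaves
  \<open>B j\<close>. So \<open>s j\<close> joins two different components.\<close>

lemma forest_star: "J \<subseteq> I \<Longrightarrow> forest (C \<union> s ` J)"
proof -
  assume "J \<subseteq> I"
  then have "finite J" using finite_I finite_subset by blast
  then show ?thesis using \<open>J \<subseteq> I\<close>
  proof (induction J rule: finite_induct)
    case empty
    then show ?case using C(2) by simp
  next
    case (insert j J)
    then have j: "j \<in> I" by blast
    then obtain x y where xy: "x \<in> W" "y \<in> B j" "s j = {x, y}" using s by blast
    have "\<not> reach (C \<union> s ` J) y x"
    proof
      assume "reach (C \<union> s ` J) y x"
      then have "x \<in> B j"
      proof (rule reach_closed[OF _ xy(2)])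
        fix a b assume ab: "{a, b} \<in> C \<union> s ` J" "a \<in> B j"
        show "b \<in> B j"
        proof (cases "{a, b} \<in> C")
          case True
          then show ?thesis using C0_step C(1) ab(2) j by blast
        next
          case False
          then obtain i where "i \<in> J" "{a, b} = s i" using ab by blast
          then show ?thesis using s_B[of i j] insert.prems insert.hyps(2) j ab(2) by blast
        qed
      qed
      then show False using xy(1) W_disjoint j by blast
    qed
    then have "forest (insert {y, x} (C \<union> s ` J))"
      using insert.IH insert.prems by (intro forest_insert) auto
    then show ?case using xy(3) by (simp add: insert_commute)
  qed
qed

text \<open>Contracting \<open>Core\<close> and deleting the edges outside \<open>Core \<union> F \<union> S\<close> leaves \<open>cone(H)\<close>, up to parallel
  edges and further edges between vertices of \<open>H\<close>; \<open>pts\<close> below is the corresponding face.\<close>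

definition T0 where "T0 = (SOME T. spanning_forest E T \<and> C \<union> s ` I \<subseteq> T)"
definition Core where "Core = T0 - s ` I"

lemma T0: "spanning_forest E T0" "C \<union> s ` I \<subseteq> T0"
proof -
  have "C \<union> s ` I \<subseteq> E" using sub_E s by blast
  then have "\<exists>T. spanning_forest E T \<and> C \<union> s ` I \<subseteq> T"
    using extend_spanning_forest[OF forest_star[OF order_refl] _ order_refl spans_refl] by metis
  then show "spanning_forest E T0" "C \<union> s ` I \<subseteq> T0"
    unfolding T0_def by (metis (mono_tags, lifting) someI_ex)+
qed

lemma T0_sub: "T0 \<subseteq> E"
  using T0(1) by (simp add: spanning_forest_iff)

lemma T0_eq: "T0 = Core \<union> s ` I"
  using T0(2) unfolding Core_def by blast

lemma C_Core: "C \<subseteq> Core"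
proof -
  have "s ` I \<subseteq> S" using s by blast
  then show ?thesis using T0(2) disjoint_C(2) unfolding Core_def by blast
qed

lemma star_reach: "x \<in> M \<Longrightarrow> y \<in> M \<Longrightarrow> reach (C \<union> s ` I) x y"
proof (rule hub)
  fix i assume i: "i \<in> I"
  then obtain x y where "x \<in> W" "y \<in> B i" "s i = {x, y}" using s by blast
  then show "\<exists>x\<in>W. \<exists>y\<in>B i. reach (C \<union> s ` I) x y"
    using i reach_edge[of x y "C \<union> s ` I"] by blast
qed auto

text \<open>\<open>C\<close> and the chosen spokes already connect \<open>M\<close>, so any further
  edge of \<open>T0\<close> between vertices of \<open>M\<close> would close a cycle.\<close>

lemma Core_FS: "Core \<inter> (F \<union> S) = {}"
proof (rule ccontr)
  assume "Core \<inter> (F \<union> S) \<noteq> {}"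
  then obtain e where e: "e \<in> T0" "e \<notin> s ` I" "e \<in> F \<union> S" unfolding Core_def by blast
  then obtain x y where xy: "x \<in> M" "y \<in> M" "e = {x, y}" using FS_in_M by blast
  have "e \<notin> C" using e(3) disjoint_C by blast
  then have "C \<union> s ` I \<subseteq> T0 - {{x, y}}" using T0(2) e(2) xy(3) by blast
  then have "reach (T0 - {{x, y}}) x y" by (rule reach_mono[OF star_reach[OF xy(1,2)]])
  then show False using forestD[of T0 x y] T0(1) e(1) xy(3) by (simp add: spanning_forest_iff)
qed

lemma card_T0: "card T0 = card Core + (k + 1)"
proof -
  have "finite T0" using T0_sub finite_edges by blast
  moreover have "card (s ` I) = k + 1" using card_image[OF inj_s] card_I by simp
  ultimately show ?thesis
    using T0(2) card_mono[of T0 "s ` I"] unfolding Core_def by (simp add: card_Diff_subset finite_I)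
qed

section \<open>The face given by the cone minor and the values of \<open>card (T \<inter> F)\<close>
  on it\<close>

definition pts where "pts = {T. spanning_forest E T \<and> Core \<subseteq> T \<and> T \<subseteq> Core \<union> F \<union> S}"

text \<open>\<open>T0\<close> is \<open>Core\<close> together with \<open>k + 1\<close> spokes, one
  for each vertex of \<open>H\<close>, and all spanning forests have its size.\<close>

lemma pts_count:
  assumes "T \<in> pts"
  shows "card (T \<inter> F) + card (T \<inter> S) = k + 1"
proof -
  have T: "spanning_forest E T" "T = Core \<union> ((T \<inter> F) \<union> (T \<inter> S))" using assms unfolding pts_def by blast+
  have fin: "finite T" using T(1) finite_edges by (simp add: spanning_forest_iff)
  have "finite Core" using T0_sub finite_edges unfolding Core_def by blast
  then have "card (Core \<union> ((T \<inter> F) \<union> (T \<inter> S))) = card Core + card ((T \<inter> F) \<union> (T \<inter> S))"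
    using Core_FS fin by (intro card_Un_disjoint) auto
  then have "card T = card Core + card ((T \<inter> F) \<union> (T \<inter> S))" using T(2) by simp
  also have "card ((T \<inter> F) \<union> (T \<inter> S)) = card (T \<inter> F) + card (T \<inter> S)"
    using disjoint(3) fin by (intro card_Un_disjoint) auto
  finally show ?thesis using spanning_forest_card[OF T(1) T0(1)] card_T0 by simp
qed

text \<open>Acyclicity comes for free: \<open>Core \<union> X\<close> spans \<open>E\<close> and has
  at most as many edges as \<open>T0\<close>, so it is a spanning forest.\<close>

lemma pts_intro:
  assumes "X \<subseteq> F \<union> S" "card X \<le> k + 1" "\<And>i. i \<in> I \<Longrightarrow> \<exists>x\<in>W. \<exists>y\<in>B i. reach (C \<union> X) x y"
  shows "Core \<union> X \<in> pts"
proof -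
  have M: "reach (Core \<union> X) x y" if "x \<in> M" "y \<in> M" for x y
  proof -
    have "reach (C \<union> X) x y" by (rule hub[OF Un_upper1 assms(3) that])
    then show ?thesis using C_Core by (auto intro: reach_mono)
  qed
  have "reach (Core \<union> X) u v" if uv: "{u, v} \<in> T0" for u v
  proof (cases "{u, v} \<in> Core")
    case True
    then show ?thesis by (intro reach_edge) blast
  next
    case False
    then obtain i where i: "i \<in> I" "{u, v} = s i" using uv unfolding T0_eq by blast
    then have "u \<in> M" "v \<in> M" using s[OF i(1)] unfolding M_def by (auto simp: doubleton_eq_iff)
    then show ?thesis by (rule M)
  qed
  then have "spans T0 (Core \<union> X)" unfolding spans_def by blast
  then have sp: "spans E (Core \<union> X)" using T0(1) spans_trans unfolding spanning_forest_iff by blast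
  have "card (Core \<union> X) \<le> card T0" using card_Un_le[of Core X] assms(2) card_T0 by simp
  moreover have "Core \<union> X \<subseteq> E" using T0_sub assms(1) sub_E unfolding Core_def by blast
  ultimately have "spanning_forest E (Core \<union> X)"
    using spanning_forest_if_card[OF T0(1) _ sp] by blast
  then show ?thesis using assms(1) unfolding pts_def by blast
qed

definition connects where
  "connects X \<longleftrightarrow> (\<forall>i\<in>I. \<forall>j\<in>I. \<forall>x\<in>B i. \<forall>y\<in>B j. reach (C \<union> X) x y)"

lemma connectsD:
  "connects X \<Longrightarrow> i \<in> I \<Longrightarrow> j \<in> I \<Longrightarrow> x \<in> B i \<Longrightarrow> y \<in> B j \<Longrightarrow> reach (C \<union> X) x y"
  unfolding connects_def by blast

text \<open>These are points at which the maximum \<open>k\<close> is attained: a tree on the base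
  and a single spoke. Equality in \<open>card X \<le> k\<close> is forced by
  \<open>pts_count\<close>.\<close>

lemma pts_tree_star:
  assumes "X \<subseteq> F" "card X \<le> k" "g \<in> S"
    and reach: "connects X"
  shows "Core \<union> (X \<union> {g}) \<in> pts" "card X = k" "(Core \<union> (X \<union> {g})) \<inter> F = X"
proof -
  obtain w y i where g: "g = {w, y}" "w \<in> W" "i \<in> I" "y \<in> B i" using assms(3) S_E by metis
  show *: "Core \<union> (X \<union> {g}) \<in> pts"
  proof (rule pts_intro)
    show "X \<union> {g} \<subseteq> F \<union> S" using assms(1,3) by blast
    show "card (X \<union> {g}) \<le> k + 1" using assms(2) card_Un_le[of X "{g}"] by simp
    fix j assume j: "j \<in> I"
    then obtain z where z: "z \<in> B j" using B_ne by blast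
    have "reach (C \<union> X) y z" by (rule connectsD[OF reach g(3) j g(4) z])
    then have "reach (C \<union> (X \<union> {g})) y z" by (rule reach_mono) blast
    moreover have "reach (C \<union> (X \<union> {g})) w y" by (rule reach_edge) (simp add: g(1))
    ultimately have "reach (C \<union> (X \<union> {g})) w z" by (meson reach_trans)
    then show "\<exists>x\<in>W. \<exists>y\<in>B j. reach (C \<union> (X \<union> {g})) x y" using g(2) z by blast
  qed
  show F: "(Core \<union> (X \<union> {g})) \<inter> F = X" using assms(1,3) Core_FS disjoint(3) by blast
  have "(Core \<union> (X \<union> {g})) \<inter> S = {g}" using assms(1,3) Core_FS disjoint(3) by blast
  then show "card X = k" using pts_count[OF *] F by simp
qed

lemma I_connected: "connected_graph I (induced_edges H I)"
proof -
  have "e \<subseteq> I" if "e \<in> H" for e using graph_H that unfolding graph_def by fastforce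
  then have "induced_edges H I = H" unfolding induced_edges_def by blast
  then show ?thesis using biconnected_H unfolding biconnected_def by simp
qed

lemma I_tree:
  obtains Y where "Y \<subseteq> F" "card Y \<le> k"
    "connects Y"
proof -
  have "I \<noteq> {}" using card_I by auto
  obtain Y where "Y \<subseteq> FJ I" "card Y \<le> card I - 1"
    "\<And>i j x y. i \<in> I \<Longrightarrow> j \<in> I \<Longrightarrow> x \<in> B i \<Longrightarrow> y \<in> B j \<Longrightarrow> reach (C \<union> Y) x y"
    by (rule tree[OF order_refl \<open>I \<noteq> {}\<close> I_connected]) blast
  then show thesis using card_I unfolding FJ_def by (intro that[of Y]) (auto simp: connects_def)
qed

text \<open>\<open>C \<union> (T \<inter> F)\<close> is a forest, and it is spanned by
  \<open>C\<close> with at most \<open>k\<close> edges that connect all the sets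
  \<open>B i\<close>.\<close>

lemma pts_le:
  assumes "T \<in> pts"
  shows "card (T \<inter> F) \<le> k"
proof -
  obtain Y where Y: "Y \<subseteq> F" "card Y \<le> k"
    "connects Y"
    using I_tree by metis
  let ?A = "C \<union> (T \<inter> F)"
  have T: "T \<subseteq> E" "forest T" "C \<subseteq> T"
    using assms C_Core unfolding pts_def spanning_forest_iff by blast+
  have "?A \<subseteq> E" using T(1) sub_E by blast
  moreover have "?A \<subseteq> T" using T(3) by blast
  then have "forest ?A" by (rule forest_subset[OF T(2)])
  moreover have "finite (C \<union> Y)"
    by (rule finite_edges) (use sub_E Y(1) in blast)
  moreover have "reach (C \<union> Y) x y" if xy: "{x, y} \<in> ?A" for x y
  proof (cases "{x, y} \<in> C")
    case True
    then show ?thesis by (intro reach_edge) blast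
  next
    case False
    then have "{x, y} \<in> F" using xy by blast
    then obtain i j where "i \<in> I" "j \<in> I" "x \<in> B i" "y \<in> B j" 
      unfolding F_def by (auto simp: doubleton_eq_iff)
    then show ?thesis by (rule connectsD[OF Y(3)])
  qed
  then have "spans ?A (C \<union> Y)" unfolding spans_def by blast
  ultimately have "card ?A \<le> card (C \<union> Y)" by (rule card_le)
  also have "\<dots> \<le> card C + k" using card_Un_le[of C Y] Y(2) by simp
  also have "card ?A = card C + card (T \<inter> F)"
    using disjoint_C(1) finite_edges[OF sub_E(4)] finite_edges[OF T(1)] by (intro card_Un_disjoint) auto
  finally show ?thesis by simp
qed

text \<open>Keep \<open>n\<close> of the \<open>k\<close> edges of a tree on the base and complete
  the forest by spokes only. This is possible because \<open>Core\<close> and the spokes already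
  contain \<open>T0\<close>.\<close>

lemma pts_values:
  assumes "n \<le> k"
  obtains T where "T \<in> pts" "card (T \<inter> F) = n"
proof -
  obtain Y where Y: "Y \<subseteq> F" "card Y \<le> k"
    "connects Y"
    using I_tree by metis
  obtain i where "i \<in> I" using card_I by fastforce
  then have "s i \<in> S" using s by blast
  note Y' = pts_tree_star[OF Y(1,2) this Y(3)]
  obtain X where X: "X \<subseteq> Y" "card X = n" using obtain_subset_with_card_n[of n Y] Y'(2) assms by auto
  have "forest (Core \<union> X)"
    using forest_subset[of "Core \<union> (Y \<union> {s i})" "Core \<union> X"] Y'(1) X(1)
    unfolding pts_def spanning_forest_iff by blast
  moreover have "Core \<union> X \<union> S \<subseteq> E" using X(1) Y(1) sub_E T0_sub unfolding Core_def by blast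
  moreover have "spans E (Core \<union> X \<union> S)"
  proof -
    have "T0 \<subseteq> Core \<union> X \<union> S" using T0_eq s by blast
    then show ?thesis using T0(1) spans_mono unfolding spanning_forest_iff by blast
  qed
  ultimately obtain T where T: "Core \<union> X \<subseteq> T" "T \<subseteq> Core \<union> X \<union> S" "spanning_forest E T"
    using extend_spanning_forest[OF _ Un_upper1] by metis
  then have "T \<in> pts" using X(1) Y(1) unfolding pts_def by blast
  moreover have "T \<inter> F = X" using T X(1) Y(1) Core_FS disjoint(3) by blast
  ultimately show thesis using that X(2) by blast
qed

section \<open>Affine functions that vanish where \<open>card (T \<inter> F)\<close> is
  maximal\<close>

context
  fixes a :: "'a set \<Rightarrow> real" and c :: real
  assumes vanish: "T \<in> pts \<Longrightarrow> card (T \<inter> F) = k \<Longrightarrow> c + sum a T = 0"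
begin

lemma coefficient_swap:
  assumes "Core \<union> (X \<union> {e}) \<in> pts" "Core \<union> (X \<union> {f}) \<in> pts"
    and "card ((Core \<union> (X \<union> {e})) \<inter> F) = k" "card ((Core \<union> (X \<union> {f})) \<inter> F) = k"
    and "e \<in> F \<union> S" "f \<in> F \<union> S" "e \<notin> X" "f \<notin> X"
  shows "a e = a f"
proof -
  have "Core \<union> (X \<union> {e}) \<subseteq> E" using assms(1) unfolding pts_def spanning_forest_iff by blast
  then have fin: "finite (Core \<union> X)" using finite_edges by blast
  have "e \<notin> Core \<union> X" "f \<notin> Core \<union> X" using assms(5-8) Core_FS by blast+
  then have "sum a (Core \<union> (X \<union> {e})) = a e + sum a (Core \<union> X)"
    "sum a (Core \<union> (X \<union> {f})) = a f + sum a (Core \<union> X)" using fin by simp_all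
  then show ?thesis using vanish[OF assms(1,3)] vanish[OF assms(2,4)] by simp
qed

text \<open>One tree on the base can be completed by either spoke, and both forests are
  zeros.\<close>

lemma coefficient_S:
  assumes "g \<in> S" "g' \<in> S"
  shows "a g = a g'"
proof -
  obtain Y where Y: "Y \<subseteq> F" "card Y \<le> k"
    "connects Y"
    using I_tree by metis
  note g = pts_tree_star[OF Y(1,2) assms(1) Y(3)] pts_tree_star[OF Y(1,2) assms(2) Y(3)]
  show ?thesis
    by (rule coefficient_swap[OF g(1) g(4)]) (use g Y(1) assms disjoint(3) in auto)
qed

text \<open>Since \<open>H - i\<close> is connected, any edge at \<open>B i\<close> completes one of its spanning trees to a
  spanning tree of \<open>H\<close>.\<close>

lemma coefficient_F_local:
  assumes i: "i \<in> I" and e: "e \<in> F" "e \<inter> B i \<noteq> {}" and f: "f \<in> F" "f \<inter> B i \<noteq> {}"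
  shows "a e = a f"
proof -
  let ?J = "I - {i}"
  have card_J: "card ?J = k" using i card_I finite_I by simp
  then have ne: "?J \<noteq> {}" using k_pos by (metis card.empty not_one_le_zero)
  have conn: "connected_graph ?J (induced_edges H ?J)"
    using biconnected_H i unfolding biconnected_def by blast
  obtain X where X: "X \<subseteq> FJ ?J" "card X \<le> card ?J - 1"
    "\<And>i j x y. i \<in> ?J \<Longrightarrow> j \<in> ?J \<Longrightarrow> x \<in> B i \<Longrightarrow> y \<in> B j \<Longrightarrow> reach (C \<union> X) x y"
    by (rule tree[OF Diff_subset ne conn]) blast
  have XF: "X \<subseteq> F" using X(1) unfolding FJ_def by blast
  have Xi: "e \<inter> B i = {}" if "e \<in> X" for e
    using that X(1) B_disjoint[of _ i] i unfolding FJ_def by blast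
  have sS: "s i \<in> S" using s i by blast
  have *: "Core \<union> ((X \<union> {e}) \<union> {s i}) \<in> pts \<and> card ((Core \<union> ((X \<union> {e}) \<union> {s i})) \<inter> F) = k"
    if e: "e \<in> F" "e \<inter> B i \<noteq> {}" for e
  proof -
    obtain x y j where xy: "e = {x, y}" "x \<in> B i" "j \<in> ?J" "y \<in> B j"
    proof -
      obtain p q m n where pq: "e = {p, q}" "m \<in> I" "n \<in> I" "m \<noteq> n" "p \<in> B m" "q \<in> B n"
        using e(1) F_E by metis
      then consider "p \<in> B i" | "q \<in> B i" using e(2) by blast
      then show thesis
      proof cases
        case 1
        then have "m = i" using B_unique pq i by blast
        then show thesis using that[of p q n] pq by blast
      next
        case 2
        then have "n = i" using B_unique pq i by blast
        then show thesis using that[of q p m] pq by blast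
      qed
    qed
    have "X \<union> {e} \<subseteq> F" using XF e(1) by blast
    moreover have "card (X \<union> {e}) \<le> k" using X(2) card_J k_pos card_Un_le[of X "{e}"] by simp
    moreover have "connects (X \<union> {e})"
      unfolding connects_def
    proof (intro ballI)
      fix m n u v assume uv: "m \<in> I" "n \<in> I" "u \<in> B m" "v \<in> B n"
      have "reach (C \<union> (X \<union> {e})) u y" if "m \<in> I" "u \<in> B m" for m u
      proof (cases "m = i")
        case True
        then have "reach (C \<union> (X \<union> {e})) u x" using reach_B[OF i, of u x] that xy(2) by blast
        moreover have "reach (C \<union> (X \<union> {e})) x y" by (rule reach_edge) (simp add: xy(1))
        ultimately show ?thesis by (rule reach_trans)
      next
        case False
        then have "reach (C \<union> X) u y" using X(3)[of m j] that xy by blast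
        then show ?thesis by (rule reach_mono) blast
      qed
      then have "reach (C \<union> (X \<union> {e})) u y" "reach (C \<union> (X \<union> {e})) v y" using uv by blast+
      then show "reach (C \<union> (X \<union> {e})) u v" by (meson reach_sym reach_trans)
    qed
    ultimately show ?thesis using pts_tree_star[OF _ _ sS, of "X \<union> {e}"] by metis
  qed
  have eq: "(X \<union> {e}) \<union> {s i} = (X \<union> {s i}) \<union> {e}" for e by blast
  have X_si: "e \<notin> X \<union> {s i}" if "e \<in> F" "e \<inter> B i \<noteq> {}" for e
    using that Xi[of e] sS disjoint(3) by blast
  show ?thesis
    by (rule coefficient_swap[OF *[OF e, unfolded eq, THEN conjunct1] *[OF f, unfolded eq, THEN conjunct1]
          *[OF e, unfolded eq, THEN conjunct2] *[OF f, unfolded eq, THEN conjunct2]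
          _ _ X_si[OF e] X_si[OF f]]) (use e f in blast)+
qed

text \<open>Equality travels along a path of \<open>H\<close>: an edge between two consecutive
  branch sets meets both of them, so the local statement applies at either end.\<close>

lemma coefficient_F:
  assumes "e \<in> F" "f \<in> F"
  shows "a e = a f"
proof -
  have meets: "\<exists>i\<in>I. e \<inter> B i \<noteq> {}" if "e \<in> F" for e
    using that by (rule F_E) blast
  obtain i j where ij: "i \<in> I" "e \<inter> B i \<noteq> {}" "j \<in> I" "f \<inter> B j \<noteq> {}" using meets assms by meson
  have "\<forall>f\<in>F. f \<inter> B j \<noteq> {} \<longrightarrow> a e = a f" if "(\<lambda>x y. {x, y} \<in> H)\<^sup>*\<^sup>* i j" for j
    using that
  proof (induction rule: rtranclp_induct)
    case base
    then show ?case using coefficient_F_local[OF ij(1) assms(1) ij(2)] by blast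
  next
    case (step j l)
    obtain x y where xy: "x \<in> B j" "y \<in> B l" "{x, y} \<in> E"
      using H_edge[OF step.hyps(2)] by blast
    have jl: "j \<noteq> l" "j \<in> I" "l \<in> I" using H_pair[OF step.hyps(2)] by blast+
    have F: "{x, y} \<in> F" by (rule F_I[OF xy(3) jl(2,3,1) xy(1,2)])
    have "{x, y} \<inter> B j \<noteq> {}" "{x, y} \<inter> B l \<noteq> {}" using xy(1,2) by simp_all
    then show ?case using step.IH[rule_format, OF F] coefficient_F_local[OF jl(3) F] by simp
  qed
  moreover have "reach H i j" using biconnected_H ij unfolding biconnected_def connected_graph_def by blast
  ultimately show ?thesis using ij(4) assms(2) unfolding reach_def by blast
qed

lemma affine_on_pts:
  obtains d where "\<And>T. T \<in> pts \<Longrightarrow> c + sum a T = d * (real (card (T \<inter> F)) - real k)"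
proof -
  obtain \<alpha> where \<alpha>: "\<And>e. e \<in> F \<Longrightarrow> a e = \<alpha>" using coefficient_F by metis
  obtain \<beta> where \<beta>: "\<And>e. e \<in> S \<Longrightarrow> a e = \<beta>" using coefficient_S by metis
  \<comment> \<open>Substituting \<open>k + 1 - card (T \<inter> F)\<close> for
    \<open>card (T \<inter> S)\<close> leaves this constant. A forest attaining the maximum then
    shows that it equals \<open>- (\<alpha> - \<beta>) * k\<close>.\<close>
  define \<kappa> where "\<kappa> = c + sum a Core + \<beta> * (k + 1)"
  have *: "c + sum a T = \<kappa> + (\<alpha> - \<beta>) * card (T \<inter> F)" if T: "T \<in> pts" for T
  proof -
    have "T = Core \<union> ((T \<inter> F) \<union> (T \<inter> S))" using T unfolding pts_def by blast
    moreover have "T \<subseteq> E" using T unfolding pts_def spanning_forest_iff by blast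
    then have "finite T" by (rule finite_edges)
    moreover from calculation have "finite Core" by (metis finite_Un)
    moreover have "Core \<inter> ((T \<inter> F) \<union> (T \<inter> S)) = {}" "(T \<inter> F) \<inter> (T \<inter> S) = {}"
      using Core_FS disjoint(3) by blast+
    ultimately have "sum a T = sum a Core + (sum a (T \<inter> F) + sum a (T \<inter> S))"
      by (metis finite_Int finite_UnI sum.union_disjoint)
    moreover have "sum a (T \<inter> F) = \<alpha> * card (T \<inter> F)" "sum a (T \<inter> S) = \<beta> * card (T \<inter> S)"
      using \<alpha> \<beta> by simp_all
    moreover have "real k + 1 = card (T \<inter> F) + card (T \<inter> S)" using pts_count[OF T] by simp
    ultimately show ?thesis unfolding \<kappa>_def by (simp add: algebra_simps)
  qed
  obtain T where "T \<in> pts" "card (T \<inter> F) = k" using pts_values[of k] by blast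
  then have "\<kappa> + (\<alpha> - \<beta>) * k = 0" using vanish * by metis
  then have "c + sum a T = (\<alpha> - \<beta>) * (real (card (T \<inter> F)) - real k)" if "T \<in> pts" for T
    using *[OF that] by (simp add: algebra_simps)
  then show thesis by (rule that)
qed

end

lemma not_level: "\<not> k_level_config E (base_config E) k"
proof -
  let ?P = "base_config E"
  have fin: "finite ?P" by (rule finite_base_config)
  have sf: "T \<subseteq> E" "finite T" if "spanning_forest E T" for T
    using that finite_edges unfolding spanning_forest_iff by blast+
  \<comment> \<open>On a spanning forest \<open>T\<close>, \<open>g\<close> counts the edges of
    \<open>Core\<close> missing from \<open>T\<close> and the edges of \<open>T\<close> outside
    \<open>Core \<union> F \<union> S\<close>. Its zeros are therefore the points of
    \<open>pts\<close>.\<close>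
  define g where "g x = real (card Core) +
    (\<Sum>e\<in>E. (if e \<in> Core then -1 else if e \<in> F \<union> S then 0 else 1) * x e)" for x :: "'a set \<Rightarrow> real"
  have g: "affine_fun_on E g" unfolding g_def by (rule affine_fun_on_linear)
  have finC: "finite Core" using T0_sub finite_edges unfolding Core_def by blast
  have g_ind: "g (ind T) = card (Core - T) + card (T - (Core \<union> F \<union> S))" if T: "spanning_forest E T" for T
  proof -
    have "g (ind T) = card Core + (\<Sum>e\<in>T. if e \<in> Core then -1 else if e \<in> F \<union> S then 0 else 1 :: real)"
      unfolding g_def using sum_ind[OF finite_E sf(1)[OF T]] by simp
    also have "(\<Sum>e\<in>T. if e \<in> Core then -1 else if e \<in> F \<union> S then 0 else 1 :: real)
      = (\<Sum>e\<in>T. (if e \<in> T - (Core \<union> F \<union> S) then 1 else 0) - (if e \<in> T \<inter> Core then 1 else 0))"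
      using Core_FS by (intro sum.cong) auto
    also have "\<dots> = card (T - (Core \<union> F \<union> S)) - real (card (T \<inter> Core))"
      unfolding sum_subtractf sum_indicator[OF sf(2)[OF T]] by (simp add: Int_absorb1 Diff_subset)
    finally show ?thesis
      using card_Diff_subset_Int[of Core T] finC card_mono[of Core "Core \<inter> T"]
      by (simp add: Int_commute of_nat_diff)
  qed
  have g_nonneg: "\<forall>v\<in>?P. g v \<ge> 0" using g_ind unfolding base_config_eq by auto
  have g_zero: "{v \<in> ?P. g v = 0} = ind ` pts"
  proof -
    have "g (ind T) = 0 \<longleftrightarrow> Core \<subseteq> T \<and> T \<subseteq> Core \<union> F \<union> S" if "spanning_forest E T" for T
    proof -
      have "g (ind T) = 0 \<longleftrightarrow> card (Core - T) = 0 \<and> card (T - (Core \<union> F \<union> S)) = 0"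
        unfolding g_ind[OF that] by linarith
      also have "\<dots> \<longleftrightarrow> Core \<subseteq> T \<and> T \<subseteq> Core \<union> F \<union> S"
        using sf(2)[OF that] finC by (simp add: Diff_eq_empty_iff del: Diff_empty Un_iff)
      finally show ?thesis .
    qed
    then show ?thesis unfolding base_config_eq pts_def by auto
  qed
  define l where "l x = real k + (\<Sum>e\<in>E. - (if e \<in> F then 1 else 0) * x e)" for x :: "'a set \<Rightarrow> real"
  have l: "affine_fun_on E l" unfolding l_def by (rule affine_fun_on_linear)
  have l_ind: "l (ind T) = real k - card (T \<inter> F)" if "T \<in> pts" for T
  proof -
    have T: "T \<subseteq> E" "finite T" using that sf unfolding pts_def by blast+
    then have "l (ind T) = k + (\<Sum>e\<in>T. - (if e \<in> F then 1 else 0 :: real))"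
      unfolding l_def sum_ind[OF finite_E T(1)] by simp
    also have "(\<Sum>e\<in>T. - (if e \<in> F then 1 else 0 :: real)) = - real (card (T \<inter> F))"
      unfolding sum_negf sum_indicator[OF T(2)] ..
    finally show ?thesis by simp
  qed
  have "facet_defining E (ind ` pts) l"
    unfolding facet_defining_def is_facet_def
  proof (intro conjI allI impI)
    show nonneg: "\<forall>v\<in>ind ` pts. l v \<ge> 0" using l_ind pts_le by simp
    show "is_face E (ind ` pts) {v \<in> ind ` pts. l v = 0}" using l nonneg unfolding is_face_def by blast
    obtain T where "T \<in> pts" "card (T \<inter> F) = 0" using pts_values[of 0] by blast
    then show "{v \<in> ind ` pts. l v = 0} \<noteq> ind ` pts" using l_ind[of T] k_pos by force
    fix F' assume F': "is_face E (ind ` pts) F' \<and> F' \<noteq> ind ` pts \<and> {v \<in> ind ` pts. l v = 0} \<subseteq> F'"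
    then obtain h where h: "affine_fun_on E h" "F' = {v \<in> ind ` pts. h v = 0}"
      unfolding is_face_def by blast
    then obtain a c where ac: "\<And>x. h x = c + (\<Sum>e\<in>E. a e * x e)" unfolding affine_fun_on_def by blast
    have h_ind: "h (ind T) = c + sum a T" if "T \<in> pts" for T
      using ac sum_ind[OF finite_E sf(1)] that unfolding pts_def by simp
    have "c + sum a T = 0" if "T \<in> pts" "card (T \<inter> F) = k" for T
    proof -
      have "ind T \<in> F'" using F' l_ind[of T] that by auto
      then show ?thesis using h(2) h_ind[OF that(1)] by simp
    qed
    then obtain d where d: "\<And>T. T \<in> pts \<Longrightarrow> c + sum a T = d * (real (card (T \<inter> F)) - real k)"
      using affine_on_pts[of c a] by blast
    \<comment> \<open>\<open>F'\<close> is a proper face, so \<open>h\<close> is not identically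
      zero on \<open>pts\<close>. As a nonzero multiple of \<open>l\<close> there, it has the same
      zeros.\<close>
    have "d \<noteq> 0"
    proof
      assume "d = 0"
      then have "h v = 0" if "v \<in> ind ` pts" for v using that h_ind d by auto
      then show False using F' h(2) by blast
    qed
    then have "h (ind T) = 0 \<longleftrightarrow> l (ind T) = 0" if "T \<in> pts" for T
      using h_ind[OF that] l_ind[OF that] d[OF that] by auto
    then show "F' = {v \<in> ind ` pts. l v = 0}" unfolding h(2) by blast
  qed (rule l)
  then obtain L c where L: "facet_defining E ?P L" "c > 0"
    "\<And>v. v \<in> ?P \<Longrightarrow> g v = 0 \<Longrightarrow> L v = c * l v"
    using facet_defining_extends_from_face[OF fin g g_nonneg] unfolding g_zero by metis
  have "(\<lambda>n. c * (real k - real n)) ` {..k} \<subseteq> L ` ?P"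
  proof
    fix r assume "r \<in> (\<lambda>n. c * (real k - real n)) ` {..k}"
    then obtain n where n: "n \<le> k" "r = c * (real k - real n)" by auto
    obtain T where T: "T \<in> pts" "card (T \<inter> F) = n" using pts_values[OF n(1)] by blast
    then have "ind T \<in> ?P" "g (ind T) = 0" using g_zero by blast+
    then show "r \<in> L ` ?P" using L(3) l_ind[OF T(1)] n(2) T(2) by (metis imageI)
  qed
  then have "card ((\<lambda>n. c * (real k - real n)) ` {..k}) \<le> card (L ` ?P)"
    using fin by (intro card_mono) auto
  moreover have "inj_on (\<lambda>n. c * (real k - real n)) {..k}" using L(2) by (auto intro: inj_onI)
  then have "card ((\<lambda>n. c * (real k - real n)) ` {..k}) = k + 1" by (simp add: card_image)
  ultimately show ?thesis using L(1) unfolding k_level_config_def by (metis add_le_same_cancel1 le_trans not_one_le_zero)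
qed

end

lemma not_level_if_cone_minor:
  assumes "graph V E" "has_cone_minor k V E"
  shows "\<not> k_level_graph V E k"
proof -
  obtain VH :: "nat set" and EH where H: "graph VH EH" "card VH = k + 1" "biconnected VH EH"
    "is_minor (cone_vertices VH) (cone_edges VH EH) V E"
    using assms(2) unfolding minimally_biconnected_def by blast
  then obtain \<beta> where
    "(\<forall>v\<in>cone_vertices VH. \<beta> v \<noteq> {} \<and> \<beta> v \<subseteq> V \<and> connected_graph (\<beta> v) (induced_edges E (\<beta> v))) \<and>
     (\<forall>u\<in>cone_vertices VH. \<forall>v\<in>cone_vertices VH. u \<noteq> v \<longrightarrow> \<beta> u \<inter> \<beta> v = {}) \<and>
     (\<forall>u v. {u, v} \<in> cone_edges VH EH \<longrightarrow> (\<exists>x\<in>\<beta> u. \<exists>y\<in>\<beta> v. {x, y} \<in> E))"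
    unfolding is_minor_def by (elim exE)
  then have \<beta>: "\<And>v. v \<in> cone_vertices VH \<Longrightarrow>
      \<beta> v \<noteq> {} \<and> \<beta> v \<subseteq> V \<and> connected_graph (\<beta> v) (induced_edges E (\<beta> v))"
    "\<And>u v. u \<in> cone_vertices VH \<Longrightarrow> v \<in> cone_vertices VH \<Longrightarrow> u \<noteq> v \<Longrightarrow> \<beta> u \<inter> \<beta> v = {}"
    "\<And>u v. {u, v} \<in> cone_edges VH EH \<Longrightarrow> \<exists>x\<in>\<beta> u. \<exists>y\<in>\<beta> v. {x, y} \<in> E"
    by simp_all
  have v: "Some i \<in> cone_vertices VH" "None \<in> cone_vertices VH" if "i \<in> VH" for i
    using that unfolding cone_vertices_def by auto
  have N: "None \<in> cone_vertices VH" unfolding cone_vertices_def by simp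
  interpret cone_model V E "\<lambda>i. \<beta> (Some i)" "\<beta> None" VH EH k
  proof (unfold_locales, goal_cases)
    \<comment> \<open>Goals 10 and 11 are \<open>H_edge\<close> and \<open>star_edge\<close>, the
      two kinds of edges of the cone.\<close>
    case (10 i j)
    have "{Some i, Some j} = Some ` {i, j}" by simp
    then have "{Some i, Some j} \<in> cone_edges VH EH" using 10 unfolding cone_edges_def by blast
    then show ?case by (rule \<beta>(3))
  next
    case (11 i)
    then have "{None, Some i} \<in> cone_edges VH EH" unfolding cone_edges_def by blast
    then show ?case by (rule \<beta>(3))
  qed (use assms(1) H \<beta>(1,2) v N in blast)+
  show ?thesis unfolding k_level_graph_def by (rule not_level)
qed

section \<open>A facet with many values yields a cone minor\<close>

context finite_graph
begin

lemma exchange_into: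
  assumes T: "spanning_forest E T" and L: "L \<subseteq> E" "\<not> tight L T"
  obtains e f where "e \<in> T - L" "f \<in> L - T" "spanning_forest E (insert f (T - {e}))"
proof -
  have T': "T \<subseteq> E" "forest T" "spans E T" using T unfolding spanning_forest_iff by blast+
  obtain u v where uv: "{u, v} \<in> L" "\<not> reach (T \<inter> L) u v"
    using L(2) unfolding tight_def spans_def by blast
  let ?f = "{u, v}"
  have f: "?f \<notin> T" using uv reach_edge[of u v "T \<inter> L"] by blast
  have "forest (T \<inter> L)" by (rule forest_subset[OF T'(2)]) blast
  then have "forest (insert ?f (T \<inter> L))" using uv(2) by (rule forest_insert)
  moreover have "insert ?f T \<subseteq> E" using T'(1) L(1) uv(1) by blast
  moreover have "spans E (insert ?f T)" by (rule spans_mono[OF T'(3)]) blast+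
  moreover have "insert ?f (T \<inter> L) \<subseteq> insert ?f T" by blast
  ultimately obtain T2 where T2: "insert ?f (T \<inter> L) \<subseteq> T2" "T2 \<subseteq> insert ?f T" "spanning_forest E T2"
    using extend_spanning_forest by metis
  have fin: "finite T" using T'(1) by (rule finite_edges)
  have c: "card T2 = card T" using spanning_forest_card[OF T2(3) T] .
  then have "T2 \<noteq> insert ?f T" using f fin by auto
  then obtain e where e: "e \<in> T" "e \<notin> T2" using T2(1,2) by blast
  have "T2 \<subseteq> insert ?f (T - {e})" using T2(2) e(2) by blast
  moreover have "card (insert ?f (T - {e})) = card T" using f fin e(1) card_Suc_Diff1[of T e] by simp
  ultimately have "T2 = insert ?f (T - {e})" using c fin by (intro card_subset_eq) auto
  then show thesis using that[of e ?f] e T2(1,3) f uv(1) by blast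
qed

lemma sum_exchange:
  fixes a :: "'a set \<Rightarrow> real"
  assumes "T \<subseteq> E" "e \<in> T" "f \<notin> T"
  shows "sum a (insert f (T - {e})) = sum a T + a f - a e"
  using assms finite_edges[of T] by (simp add: sum_diff1)

text \<open>Zeros of \<open>c + \<Sum> a\<close> are the spanning forests of least weight, so by the greedy algorithm they
  span every sublevel set of \<open>a\<close>.\<close>

lemma tight_sublevel:
  fixes a :: "'a set \<Rightarrow> real"
  assumes nonneg: "\<And>T. spanning_forest E T \<Longrightarrow> c + sum a T \<ge> 0"
    and zero: "spanning_forest E T0" "c + sum a T0 = 0"
    and nonzero: "spanning_forest E T1" "c + sum a T1 \<noteq> 0"
  obtains X T where "X \<subseteq> E" "\<And>T. spanning_forest E T \<Longrightarrow> c + sum a T = 0 \<Longrightarrow> tight X T"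
    "spanning_forest E T" "\<not> tight X T"
proof -
  define L where "L t = {e \<in> E. a e \<le> t}" for t
  have L: "L t \<subseteq> E" for t unfolding L_def by blast
  have greedy: "tight (L t) T" if T: "spanning_forest E T" "c + sum a T = 0" for t T
  proof (rule ccontr)
    assume "\<not> tight (L t) T"
    then obtain e f where ef: "e \<in> T - L t" "f \<in> L t - T" "spanning_forest E (insert f (T - {e}))"
      using exchange_into[OF T(1) L] by metis
    have TE: "T \<subseteq> E" using T(1) unfolding spanning_forest_iff by blast
    have "a f < a e" using ef(1,2) TE unfolding L_def by auto
    moreover have "sum a (insert f (T - {e})) = sum a T + a f - a e"
      using ef TE by (intro sum_exchange) auto
    ultimately show False using nonneg[OF ef(3)] T(2) by simp
  qed
  let ?P = "\<lambda>T. spanning_forest E T \<and> c + sum a T \<noteq> 0"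
  \<comment> \<open>Take a nonzero forest closest to \<open>T0\<close>. One exchange towards
    \<open>T0\<close> must give a zero, so it replaces \<open>e\<close> by a lighter
    \<open>f\<close>; the sublevel set at \<open>a f\<close> then gains an edge and was not spanned
    by \<open>T\<close>.\<close>
  obtain T where T: "?P T" "\<And>T'. ?P T' \<Longrightarrow> card (T - T0) \<le> card (T' - T0)"
    using ex_has_least_nat[where P = ?P and k = T1 and m = "\<lambda>T. card (T - T0)"] nonzero by metis
  have TE: "T \<subseteq> E" and finT: "finite T" using T(1) finite_edges unfolding spanning_forest_iff by blast+
  have "\<not> T \<subseteq> T0"
  proof
    assume "T \<subseteq> T0"
    moreover have "finite T0" using zero(1) finite_edges unfolding spanning_forest_iff by blast
    moreover have "card T = card T0" using spanning_forest_card T(1) zero(1) by blast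
    ultimately have "T = T0" by (intro card_subset_eq)
    then show False using T(1) zero(2) by simp
  qed
  then obtain e where e: "e \<in> T - T0" by blast
  then obtain f where f: "f \<in> T0 - T" "spanning_forest E (insert f (T - {e}))"
    using spanning_forest_exchange[OF _ zero(1)] T(1) by blast
  let ?T = "insert f (T - {e})"
  have "card (?T - T0) < card (T - T0)" using e f(1) finT by (intro psubset_card_mono) auto
  then have zero': "c + sum a ?T = 0" using T(2)[of ?T] f(2) by force
  have "sum a ?T = sum a T + a f - a e" using e f(1) TE by (intro sum_exchange) auto
  moreover have "c + sum a T > 0" using T(1) nonneg[of T] by simp
  ultimately have less: "a f < a e" using zero' by simp
  have "\<not> tight (L (a f)) T"
  proof
    assume "tight (L (a f)) T"
    then have "card (?T \<inter> L (a f)) \<le> card (T \<inter> L (a f))" using tight_max T(1) f(2) by blast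
    moreover have "f \<in> E" using f(2) unfolding spanning_forest_iff by blast
    then have "?T \<inter> L (a f) = insert f (T \<inter> L (a f))" using less unfolding L_def by auto
    ultimately show False using f(1) finT by simp
  qed
  then show thesis using that[of "L (a f)" T] L greedy T(1) by blast
qed

section \<open>Faces cut out by tight edge sets\<close>

lemma tight_function:
  assumes "X \<subseteq> E"
  obtains m :: real and h where "affine_fun_on E h"
    "\<And>T. spanning_forest E T \<Longrightarrow> h (ind T) = m - card (T \<inter> X)"
    "\<And>T. spanning_forest E T \<Longrightarrow> h (ind T) \<ge> 0"
    "\<And>T. spanning_forest E T \<Longrightarrow> h (ind T) = 0 \<longleftrightarrow> tight X T"
proof -
  obtain T1 where T1: "spanning_forest E T1" "tight X T1" using exists_tight[OF assms] by metis
  define m where "m = card (T1 \<inter> X)"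
  define h where "h x = real m + (\<Sum>e\<in>E. - (if e \<in> X then 1 else 0) * x e)" for x :: "'a set \<Rightarrow> real"
  have h: "h (ind T) = real m - card (T \<inter> X)" if "spanning_forest E T" for T
  proof -
    have T: "T \<subseteq> E" using that unfolding spanning_forest_iff by blast
    show ?thesis unfolding h_def sum_ind[OF finite_E T] sum_negf sum_indicator[OF finite_edges[OF T]] by simp
  qed
  show thesis
  proof (rule that[of h "real m"])
    show "affine_fun_on E h" unfolding h_def by (rule affine_fun_on_linear)
    fix T assume T: "spanning_forest E T"
    show "h (ind T) = real m - card (T \<inter> X)" by (rule h[OF T])
    show "h (ind T) \<ge> 0" unfolding h[OF T] m_def using tight_max[OF T1(1) T T1(2)] by simp
    show "h (ind T) = 0 \<longleftrightarrow> tight X T"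
      unfolding h[OF T] m_def using tight_iff_card[OF T1(1) T T1(2) assms] by auto
  qed
qed

text \<open>This allows one edge set to be replaced by another: whenever \<open>X\<close> is tight
  on the facet but not everywhere, proportionality makes it define the same facet and express
  \<open>l\<close> through \<open>card (T \<inter> X)\<close>. It is used both for shrinking
  \<open>X\<close> and for passing to the complement of a part.\<close>

lemma facet_from_tight:
  assumes l: "facet_defining E (base_config E) l" and X: "X \<subseteq> E"
    and zero: "\<And>T. spanning_forest E T \<Longrightarrow> l (ind T) = 0 \<Longrightarrow> tight X T"
    and T0: "spanning_forest E T0" "\<not> tight X T0"
  obtains m d :: real where "d > 0"
    "\<And>T. spanning_forest E T \<Longrightarrow> m - card (T \<inter> X) = d * l (ind T)"
    "\<And>T. spanning_forest E T \<Longrightarrow> l (ind T) = 0 \<longleftrightarrow> tight X T"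
proof -
  let ?P = "base_config E"
  obtain m :: real and h where h: "affine_fun_on E h"
    "\<And>T. spanning_forest E T \<Longrightarrow> h (ind T) = m - card (T \<inter> X)"
    "\<And>T. spanning_forest E T \<Longrightarrow> h (ind T) \<ge> 0"
    "\<And>T. spanning_forest E T \<Longrightarrow> h (ind T) = 0 \<longleftrightarrow> tight X T"
    using tight_function[OF X] by metis
  have pos: "\<forall>v\<in>?P. h v \<ge> 0" using h(3) unfolding base_config_eq by auto
  have ne: "\<exists>v\<in>?P. h v \<noteq> 0" using h(4) T0 unfolding base_config_eq by auto
  have z: "h v = 0" if "v \<in> ?P" "l v = 0" for v
    using that h(4) zero unfolding base_config_eq by auto
  obtain d where d: "d > 0" "\<forall>v\<in>?P. h v = d * l v"
    by (rule facet_functions_proportional[OF finite_base_config l h(1) pos z ne])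
  have eq: "h (ind T) = d * l (ind T)" if "spanning_forest E T" for T
    using d(2) that unfolding base_config_eq by blast
  show thesis
  proof (rule that[OF d(1), of m])
    fix T assume T: "spanning_forest E T"
    show "m - card (T \<inter> X) = d * l (ind T)" using h(2)[OF T] eq[OF T] by simp
    show "l (ind T) = 0 \<longleftrightarrow> tight X T" using h(4)[OF T] eq[OF T] d(1) by auto
  qed
qed

text \<open>Collapsing the vertices of \<open>X2\<close> to \<open>x\<close>, the only vertex it may
  share with \<open>X1\<close>, fixes the vertices of \<open>X1\<close> and turns a path in
  \<open>T \<inter> (X1 \<union> X2)\<close> into one in \<open>T \<inter> X1\<close>.\<close>

lemma tight_split:
  assumes "X1 \<union> X2 \<subseteq> E" "\<Union>X1 \<inter> \<Union>X2 \<subseteq> {x}" "tight (X1 \<union> X2) T"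
  shows "tight X1 T"
  unfolding tight_def spans_def
proof (intro allI impI)
  fix u v assume uv: "{u, v} \<in> X1"
  define h where "h y = (if y \<in> \<Union>X2 then x else y)" for y
  have h1: "h y = y" if "y \<in> \<Union>X1" for y using that assms(2) unfolding h_def by auto
  have "reach (T \<inter> (X1 \<union> X2)) u v" using assms(3) uv unfolding tight_def spans_def by blast
  then have "reach (T \<inter> X1) (h u) (h v)"
  proof (rule reach_image)
    fix p q assume pq: "{p, q} \<in> T \<inter> (X1 \<union> X2)"
    show "reach (T \<inter> X1) (h p) (h q)"
    proof (cases "{p, q} \<in> X1")
      case True
      then have "h p = p" "h q = q" using h1 by blast+
      then show ?thesis using True pq reach_edge[of p q "T \<inter> X1"] by simp
    next
      case False
      then have "{p, q} \<in> X2" using pq by blast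
      then have "p \<in> \<Union>X2" "q \<in> \<Union>X2" by blast+
      then show ?thesis unfolding h_def by simp
    qed
  qed
  then show "reach (T \<inter> X1) u v" using h1 uv by (metis UnionI insertI1 insert_commute)
qed

lemma tight_Un: "tight X1 T \<Longrightarrow> tight X2 T \<Longrightarrow> tight (X1 \<union> X2) T"
  unfolding tight_def by (intro spans_Un) (auto elim: spans_mono)

text \<open>If a vertex set \<open>A\<close> can be left only towards \<open>x\<close>, then the
  edges meeting \<open>A\<close> and the remaining edges share at most \<open>x\<close>. A failure
  of connectedness, before or after the deletion of a vertex, yields such a set.\<close>

lemma biconnected_if_no_split:
  assumes X: "X \<subseteq> E" "X \<noteq> {}"
    and no_split: "\<And>X1 X2 x. X1 \<noteq> {} \<Longrightarrow> X2 \<noteq> {} \<Longrightarrow> X1 \<inter> X2 = {} \<Longrightarrow> X1 \<union> X2 = X \<Longrightarrow>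
      \<not> \<Union>X1 \<inter> \<Union>X2 \<subseteq> {x}"
  shows "biconnected (\<Union>X) X"
proof -
  have XV: "\<Union>X \<subseteq> V" using X(1) edgeE by blast
  have no_closed: False
    if nc: "a \<in> A" "a \<in> \<Union>X" "b \<in> \<Union>X" "b \<notin> A" "b \<noteq> x"
      "\<And>p q. {p, q} \<in> X \<Longrightarrow> p \<in> A \<Longrightarrow> q \<in> A \<union> {x}" for a b x A
  proof -
    define X1 where "X1 = {e \<in> X. e \<inter> A \<noteq> {}}"
    have inA: "e \<subseteq> A \<union> {x}" if "e \<in> X1" for e
    proof -
      have "e \<in> X" "e \<inter> A \<noteq> {}" using that unfolding X1_def by auto
      then obtain p where "p \<in> e" "p \<in> A" by blast
      moreover obtain u v where "e = {u, v}" using \<open>e \<in> X\<close> X(1) edgeE by blast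
      ultimately obtain q where "e = {p, q}" by auto
      then show ?thesis using nc(6)[of p q] \<open>e \<in> X\<close> \<open>p \<in> A\<close> by simp
    qed
    have "X1 \<noteq> {}" using nc(1,2) unfolding X1_def by blast
    moreover have "X - X1 \<noteq> {}"
    proof -
      obtain e where "e \<in> X" "b \<in> e" using nc(3) by blast
      then have "e \<notin> X1" using inA nc(4,5) by blast
      then show ?thesis using \<open>e \<in> X\<close> by blast
    qed
    moreover have "X1 \<subseteq> X" unfolding X1_def by blast
    moreover have "\<Union>X1 \<inter> \<Union>(X - X1) \<subseteq> {x}" using inA unfolding X1_def by blast
    ultimately show False using no_split[of X1 "X - X1" x] by blast
  qed
  obtain e where "e \<in> X" using X(2) by blast
  then obtain u v where uv: "u \<noteq> v" "{u, v} \<subseteq> \<Union>X" using X(1) edgeE by (metis Union_upper subsetD)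
  show ?thesis
    unfolding biconnected_def
  proof (intro conjI ballI)
    show "card (\<Union>X) \<ge> 2"
      using card_mono[OF finite_subset[OF XV finite_V] uv(2)] uv(1) by simp
    show "connected_graph (\<Union>X) X"
      unfolding connected_graph_def
    proof (intro ballI, rule ccontr)
      fix u v assume uv: "u \<in> \<Union>X" "v \<in> \<Union>X" "\<not> reach X u v"
      \<comment> \<open>Nothing has been deleted here, so \<open>u\<close>, which lies in its own
        class anyway, takes the role of the exceptional vertex.\<close>
      show False
      proof (rule no_closed[of u "{z. reach X u z}" v u])
        fix p q assume "{p, q} \<in> X" "p \<in> {z. reach X u z}"
        then show "q \<in> {z. reach X u z} \<union> {u}"
          using reach_trans[of X u p q] reach_edge[of p q X] by simp
      next
        show "v \<noteq> u" using uv(3) by auto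
      qed (use uv in auto)
    qed
    fix x assume x: "x \<in> \<Union>X"
    let ?G = "induced_edges X (\<Union>X - {x})"
    show "connected_graph (\<Union>X - {x}) ?G"
      unfolding connected_graph_def
    proof (intro ballI, rule ccontr)
      fix u v assume uv: "u \<in> \<Union>X - {x}" "v \<in> \<Union>X - {x}" "\<not> reach ?G u v"
      have avoid: "z \<noteq> x" if "reach ?G u z" for z
        using reach_closed[OF that, of "- {x}"] uv(1) by (auto simp: induced_edges_iff)
      show False
      proof (rule no_closed[of u "{z. reach ?G u z}" v x])
        fix p q assume pq: "{p, q} \<in> X" "p \<in> {z. reach ?G u z}"
        show "q \<in> {z. reach ?G u z} \<union> {x}"
        proof (cases "q = x")
          case False
          then have "{p, q} \<in> ?G" using pq avoid[of p] by (auto simp: induced_edges_iff)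
          then have "reach ?G p q" by (rule reach_edge)
          then show ?thesis using pq(2) reach_trans[of ?G u p q] by simp
        qed simp
      qed (use uv in auto)
    qed
  qed
qed

text \<open>Collapse \<open>R\<close> to a vertex of \<open>\<Union>X\<close>. Every edge of
  \<open>D\<close> on a path in \<open>T\<close> then joins two vertices of
  \<open>\<Union>X\<close>, and \<open>T \<inter> X\<close> connects those without using
  \<open>D\<close>.\<close>

lemma tight_complement:
  assumes T: "spanning_forest E T" "tight X T" and X: "X \<subseteq> E" "connected_graph (\<Union>X) X" "X \<noteq> {}"
    and D: "D \<subseteq> E - X" "\<And>p q. {p, q} \<in> D \<Longrightarrow> p \<in> \<Union>X \<union> R"
    and R: "\<And>p q. {p, q} \<in> E - D \<Longrightarrow> p \<notin> R" "R \<inter> \<Union>X = {}"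
  shows "tight (E - D) T"
  unfolding tight_def spans_def
proof (intro allI impI)
  fix u v assume uv: "{u, v} \<in> E - D"
  obtain e where e: "e \<in> X" using X(3) by blast
  then obtain r where r: "r \<in> \<Union>X" using X(1) edgeE by (metis UnionI insertI1 subsetD)
  define h where "h y = (if y \<in> R then r else y)" for y
  let ?G = "T \<inter> (E - D)"
  have XG: "T \<inter> X \<subseteq> ?G" using X(1) D(1) by blast
  have rX: "reach ?G y z" if "y \<in> \<Union>X" "z \<in> \<Union>X" for y z
  proof -
    have "reach X y z" using X(2) that unfolding connected_graph_def by blast
    then have "reach (T \<inter> X) y z" using T(2) spans_reach unfolding tight_def by metis
    then show ?thesis using XG by (rule reach_mono)
  qed
  have "reach T u v" using T(1) uv unfolding spanning_forest_iff spans_def by blast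
  then have "reach ?G (h u) (h v)"
  proof (rule reach_image)
    fix p q assume pq: "{p, q} \<in> T"
    have qp: "{q, p} = {p, q}" by (rule insert_commute)
    show "reach ?G (h p) (h q)"
    proof (cases "{p, q} \<in> D")
      case True
      then have "p \<in> \<Union>X \<union> R" "q \<in> \<Union>X \<union> R" using D(2)[of p q] D(2)[of q p] qp by simp_all
      then have "h p \<in> \<Union>X" "h q \<in> \<Union>X" using r unfolding h_def by auto
      then show ?thesis by (rule rX)
    next
      case False
      moreover have "{p, q} \<in> E" using pq T(1) unfolding spanning_forest_iff by blast
      ultimately have "{p, q} \<in> E - D" by blast
      moreover from this have "p \<notin> R" "q \<notin> R" using R(1)[of p q] R(1)[of q p] qp by simp_all
      ultimately show ?thesis using pq reach_edge[of p q ?G] unfolding h_def by simp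
    qed
  qed
  moreover have "u \<notin> R" "v \<notin> R" using uv R(1)[of u v] R(1)[of v u] by (simp_all add: insert_commute)
  ultimately show "reach ?G u v" unfolding h_def by simp
qed

text \<open>A spanning forest \<open>T\<close> together with a star on the attachments \<open>N\<close> of \<open>R\<close> spans all edges at
  \<open>R\<close>, since \<open>N\<close> is the only way out of \<open>R\<close>.\<close>

lemma attachment_bound:
  assumes T: "spanning_forest E T" and A: "A \<subseteq> D" "forest A"
    and D: "D = {e \<in> E. e \<inter> R \<noteq> {}}"
    and N: "N \<subseteq> V" "\<And>p q. {p, q} \<in> E \<Longrightarrow> p \<in> R \<Longrightarrow> q \<in> R \<union> N"
  shows "card A \<le> card (T \<inter> D) + (card N - 1)"
proof -
  \<comment> \<open>If \<open>N\<close> is empty, \<open>r\<close> is arbitrary and \<open>Q\<close>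
    is empty, in agreement with the truncated difference \<open>card N - 1 = 0\<close>.\<close>
  define r where "r = (SOME n. n \<in> N)"
  define Q where "Q = (\<lambda>n. {r, n}) ` (N - {r})"
  let ?B = "(T \<inter> D) \<union> Q"
  have star: "reach ?B r n" if "n \<in> insert r N" for n
  proof (cases "n = r")
    case False
    then show ?thesis using that unfolding Q_def by (intro reach_edge) blast
  qed simp
  have star2: "reach ?B n n'" if "n \<in> insert r N" "n' \<in> insert r N" for n n'
    using star[OF that(1)] star[OF that(2)] by (meson reach_sym reach_trans)
  \<comment> \<open>Everything beyond \<open>N\<close> is collapsed to the centre of the star. A
    path in \<open>T\<close> keeps its edges in \<open>D\<close>, and each of its other edges joins
    two vertices of the star.\<close>
  define h where "h y = (if y \<in> R \<union> N then y else r)" for y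
  have Dpq: "p \<in> R \<union> N" if "{p, q} \<in> D" for p q
  proof -
    have "{p, q} \<in> E" "p \<in> R \<or> q \<in> R" using that unfolding D by auto
    then show ?thesis using N(2)[of q p] by (auto simp: insert_commute)
  qed
  have "reach ?B u v" if uv: "{u, v} \<in> A" for u v
  proof -
    have uvD: "{u, v} \<in> D" "{v, u} \<in> D" using uv A(1) by (auto simp: insert_commute)
    then have "reach T u v" using T unfolding D spanning_forest_iff spans_def by blast
    then have "reach ?B (h u) (h v)"
    proof (rule reach_image)
      fix p q assume pq: "{p, q} \<in> T"
      then have pqE: "{p, q} \<in> E" using T unfolding spanning_forest_iff by blast
      show "reach ?B (h p) (h q)"
      proof (cases "{p, q} \<in> D")
        case True
        then have "h p = p" "h q = q" using Dpq[of p q] Dpq[of q p] unfolding h_def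
          by (simp_all add: insert_commute)
        then show ?thesis using True pq reach_edge[of p q ?B] by simp
      next
        case False
        then have "p \<notin> R" "q \<notin> R" using pqE unfolding D by auto
        then have "h p \<in> insert r N" "h q \<in> insert r N" unfolding h_def by auto
        then show ?thesis by (rule star2)
      qed
    qed
    moreover have "h u = u" "h v = v" using Dpq uvD unfolding h_def by metis+
    ultimately show ?thesis by simp
  qed
  then have "spans A ?B" unfolding spans_def by blast
  moreover have "A \<subseteq> E" using A(1) unfolding D by blast
  moreover have "T \<inter> D \<subseteq> E" unfolding D by blast
  then have "finite (T \<inter> D)" by (rule finite_edges)
  moreover have finN: "finite N" using N(1) finite_V finite_subset by blast
  then have "finite Q" unfolding Q_def by simp
  ultimately have "card A \<le> card ?B" using card_le A(2) by blast
  also have "\<dots> \<le> card (T \<inter> D) + card Q" by (rule card_Un_le)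
  also have "card Q \<le> card (N - {r})" unfolding Q_def using finN by (intro card_image_le) simp
  also have "card (N - {r}) = card N - 1"
  proof (cases "N = {}")
    case False
    then have "r \<in> N" unfolding r_def by (simp add: some_in_eq)
    then show ?thesis using finN by simp
  qed simp
  finally show ?thesis by simp
qed

end

section \<open>From \<open>k + 1\<close> values of a facet function to \<open>k + 1\<close>
  attachments\<close>

lemma exists_gap:
  fixes S :: "nat set"
  assumes "finite S" "card S \<ge> k + 1"
  obtains a b where "a \<in> S" "b \<in> S" "b \<ge> a + k"
proof -
  have "S \<noteq> {}" using assms(2) by auto
  moreover have "S \<subseteq> {Min S..Max S}" using assms(1) by auto
  then have "card S \<le> card {Min S..Max S}" by (intro card_mono) auto
  then have "Max S \<ge> Min S + k" using assms(2) by simp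
  ultimately show thesis using that assms(1) Min_in Max_in by blast
qed

lemma cone_minor_if_not_level:
  assumes "graph V E" "k \<ge> 1" "\<not> k_level_graph V E k"
  shows "has_cone_minor k V E"
proof -
  interpret finite_graph V E by unfold_locales (rule assms(1))
  let ?P = "base_config E"
  obtain l where l: "facet_defining E ?P l" and many: "card (l ` ?P) \<ge> k + 1"
    using assms(3) unfolding k_level_graph_def k_level_config_def by (auto simp: not_le)
  have fl: "affine_fun_on E l" "\<forall>v\<in>?P. l v \<ge> 0" "is_facet E ?P {v \<in> ?P. l v = 0}"
    using l unfolding facet_defining_def by auto
  obtain a c where ac: "\<And>x. l x = c + (\<Sum>e\<in>E. a e * x e)" using fl(1) unfolding affine_fun_on_def by blast
  have l_ind: "l (ind T) = c + sum a T" if T: "spanning_forest E T" for T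
  proof -
    have "T \<subseteq> E" using T unfolding spanning_forest_iff by blast
    then show ?thesis using ac sum_ind[OF finite_E] by simp
  qed
  obtain T1 where T1: "spanning_forest E T1" "l (ind T1) \<noteq> 0"
    using fl(3) unfolding is_facet_def base_config_eq by blast
  \<comment> \<open>The definition of a facet admits the empty set. In that case subtracting the
    minimum of \<open>l\<close> gives a nonempty face, hence all of \<open>?P\<close>, and
    \<open>l\<close> is constant, whereas it takes at least \<open>k + 1 \<ge> 2\<close>
    values.\<close>
  obtain T0 where T0: "spanning_forest E T0" "l (ind T0) = 0"
  proof (rule ccontr)
    assume "\<not> thesis"
    then have Z: "{v \<in> ?P. l v = 0} = {}" using that unfolding base_config_eq by blast
    define m where "m = Min (l ` ?P)"
    have "l ` ?P \<noteq> {}" using many by auto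
    then have "m \<in> l ` ?P" using finite_base_config unfolding m_def by (intro Min_in) auto
    then obtain v where v: "v \<in> ?P" "l v = m" by auto
    define h where "h x = 1 * l x + (-1) * m" for x
    have "affine_fun_on E h"
      unfolding h_def by (rule affine_fun_on_comb[OF fl(1) affine_fun_on_const])
    moreover have "\<forall>v\<in>?P. h v \<ge> 0"
      using finite_base_config unfolding h_def m_def by simp
    ultimately have "is_face E ?P {v \<in> ?P. h v = 0}" unfolding is_face_def by blast
    moreover have "{v \<in> ?P. h v = 0} \<noteq> {}" using v unfolding h_def by auto
    ultimately have "{v \<in> ?P. h v = 0} = ?P" using fl(3) Z unfolding is_facet_def by auto
    then have "l ` ?P \<subseteq> {m}" unfolding h_def by auto
    then have "card (l ` ?P) \<le> 1" using card_mono[of "{m}" "l ` ?P"] by simp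
    then show False using many assms(2) by simp
  qed
  define facet where "facet X \<longleftrightarrow> X \<subseteq> E \<and> (\<forall>T. spanning_forest E T \<longrightarrow> (l (ind T) = 0 \<longleftrightarrow> tight X T))" for X
  have facetI: "facet X" if "X \<subseteq> E" "\<And>T. spanning_forest E T \<Longrightarrow> l (ind T) = 0 \<Longrightarrow> tight X T"
    "spanning_forest E T" "\<not> tight X T" for X T
    using facet_from_tight[OF l that] that(1) unfolding facet_def by metis
  have nonneg: "c + sum a T \<ge> 0" if "spanning_forest E T" for T
    using fl(2) l_ind[OF that] that unfolding base_config_eq by auto
  have "\<exists>X. facet X"
  proof -
    have "c + sum a T0 = 0" "c + sum a T1 \<noteq> 0" using T0 T1 l_ind by auto
    then obtain X T where X: "X \<subseteq> E" "\<And>T. spanning_forest E T \<Longrightarrow> c + sum a T = 0 \<Longrightarrow> tight X T"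
      "spanning_forest E T" "\<not> tight X T"
      using tight_sublevel[OF nonneg T0(1) _ T1(1)] by metis
    have "facet X" by (rule facetI[OF X(1) _ X(3,4)]) (use X(2) l_ind in simp)
    then show ?thesis by blast
  qed
  then obtain X where X: "facet X" "\<And>Y. facet Y \<Longrightarrow> card X \<le> card Y"
    using ex_has_least_nat[of facet _ card] by blast
  have XE: "X \<subseteq> E" and Xl: "\<And>T. spanning_forest E T \<Longrightarrow> l (ind T) = 0 \<longleftrightarrow> tight X T"
    using X(1) unfolding facet_def by auto
  have "X \<noteq> {}" using Xl[OF T1(1)] T1(2) by (auto simp: tight_def spans_def)
  let ?U = "\<Union>X"
  \<comment> \<open>If \<open>X\<close> split into two sets sharing at most one vertex, both would
    be tight on the facet and one of them would not be tight at \<open>T1\<close>. That smaller set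
    would define the same facet.\<close>
  have bi: "biconnected ?U X"
  proof (rule biconnected_if_no_split[OF XE \<open>X \<noteq> {}\<close>])
    fix X1 X2 x
    assume s: "X1 \<noteq> {}" "X2 \<noteq> {}" "X1 \<inter> X2 = {}" "X1 \<union> X2 = X"
    show "\<not> \<Union>X1 \<inter> \<Union>X2 \<subseteq> {x}"
    proof
      assume x: "\<Union>X1 \<inter> \<Union>X2 \<subseteq> {x}"
      have "finite X" using XE by (rule finite_edges)
      then have less: "card X1 < card X" "card X2 < card X" using s by (auto intro!: psubset_card_mono)
      have t1: "tight X1 T" if "tight X T" for T
        using tight_split[of X1 X2 x T] that s(4) x XE by simp
      have t2: "tight X2 T" if "tight X T" for T
        using tight_split[of X2 X1 x T] that s(4) x XE by (simp add: Un_commute Int_commute)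
      have "\<not> tight X T1" using Xl T1 by blast
      then have "\<not> tight X1 T1 \<or> \<not> tight X2 T1" using tight_Un s(4) by blast
      then have "facet X1 \<or> facet X2"
        using facetI[OF _ _ T1(1)] t1 t2 Xl s(4) XE by (metis Un_upper1 Un_upper2 order_trans)
      then show False using X(2) less by (metis leD)
    qed
  qed
  have connX: "connected_graph ?U X" using bi unfolding biconnected_def by blast
  have UV: "?U \<subseteq> V" using XE edgeE by blast
  let ?G = "induced_edges E (V - ?U)"
  define R where "R w = {z. reach ?G w z}" for w
  define D where "D w = {e \<in> E. e \<inter> R w \<noteq> {}}" for w
  \<comment> \<open>After contracting \<open>X\<close>, an edge inside \<open>?U\<close> is a loop
    and any other remaining edge meets a component outside \<open>?U\<close>. \<open>D w\<close>
    depends only on the component of \<open>w\<close>, so different members are disjoint.\<close>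
  define parts where "parts = (\<lambda>e. {e}) ` {e \<in> E - X. e \<subseteq> ?U} \<union> D ` (V - ?U)"
  have R_sub: "R w \<subseteq> V - ?U" if "w \<in> V - ?U" for w
  proof
    fix z assume "z \<in> R w"
    then show "z \<in> V - ?U"
      using reach_closed[of ?G w z "V - ?U"] that unfolding R_def by (auto simp: induced_edges_iff)
  qed
  have R_step: "q \<in> R w" if "{p, q} \<in> E" "p \<in> R w" "q \<notin> ?U" "w \<in> V - ?U" for p q w
  proof -
    have "{p, q} \<in> ?G" using that R_sub[OF that(4)] edge_pair[OF that(1)] by (auto simp: induced_edges_iff)
    then have "reach ?G p q" by (rule reach_edge)
    then show ?thesis using that(2) unfolding R_def by (auto intro: reach_trans)
  qed
  have D_tight: "tight (E - D w) T"
    if w: "w \<in> V - ?U" and T: "spanning_forest E T" "tight X T" for w T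
  proof (rule tight_complement[OF T XE connX \<open>X \<noteq> {}\<close>, of _ "R w"])
    show "D w \<subseteq> E - X" using R_sub[OF w] unfolding D_def by blast
    show "R w \<inter> ?U = {}" using R_sub[OF w] by blast
    fix p q
    show "p \<notin> R w" if "{p, q} \<in> E - D w" using that unfolding D_def by auto
    show "p \<in> ?U \<union> R w" if "{p, q} \<in> D w"
    proof -
      have "{p, q} \<in> E" "{q, p} \<in> E" "p \<in> R w \<or> q \<in> R w"
        using that unfolding D_def by (auto simp: insert_commute)
      then show ?thesis using R_step[of q p w] w by blast
    qed
  qed
  have loop_tight: "tight (E - {e}) T"
    if e: "e \<in> E - X" "e \<subseteq> ?U" and T: "spanning_forest E T" "tight X T" for e T
    by (rule tight_complement[OF T XE connX \<open>X \<noteq> {}\<close>, of _ "{}"]) (use e in auto)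
  have part_tight: "tight (E - Y) T" if "Y \<in> parts" "spanning_forest E T" "l (ind T) = 0" for Y T
    using that D_tight loop_tight Xl unfolding parts_def by auto
  have parts_Un: "\<Union>parts = E - X"
  proof
    show "\<Union>parts \<subseteq> E - X" using R_sub unfolding parts_def D_def by blast
    show "E - X \<subseteq> \<Union>parts"
    proof
      fix e assume e: "e \<in> E - X"
      show "e \<in> \<Union>parts"
      proof (cases "e \<subseteq> ?U")
        case True
        then show ?thesis using e unfolding parts_def by blast
      next
        case False
        then obtain w where w: "w \<in> e" "w \<notin> ?U" by blast
        then have "w \<in> V - ?U" using e edgeE[of e] by blast
        moreover have "w \<in> R w" unfolding R_def by simp
        then have "e \<in> D w" using w(1) e unfolding D_def by blast
        ultimately show ?thesis unfolding parts_def by blast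
      qed
    qed
  qed
  have D_eq: "D w = D w'" if ww: "w \<in> V - ?U" "w' \<in> V - ?U" and e: "e \<in> D w" "e \<in> D w'" for w w' e
  proof -
    obtain p q where pq: "p \<in> e" "p \<in> R w" "q \<in> e" "q \<in> R w'" using e unfolding D_def by blast
    have "q \<in> R w"
    proof (cases "p = q")
      case False
      have "e \<in> E" using e(1) unfolding D_def by blast
      then obtain x y where "e = {x, y}" by (rule edgeE)
      then have "{p, q} \<in> E" using pq(1,3) False \<open>e \<in> E\<close> by (auto simp: insert_commute)
      then show ?thesis using R_step[OF _ pq(2) _ ww(1)] R_sub[OF ww(2)] pq(4) by blast
    qed (use pq in simp)
    then have "reach ?G w q" "reach ?G w' q" using pq(4) unfolding R_def by auto
    then have ww': "reach ?G w w'" "reach ?G w' w" by (meson reach_sym reach_trans)+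
    then have "reach ?G w z \<longleftrightarrow> reach ?G w' z" for z by (meson reach_trans)
    then have "R w = R w'" unfolding R_def by blast
    then show ?thesis unfolding D_def by simp
  qed
  have disj: "Y \<inter> Y' = {}" if YY: "Y \<in> parts" "Y' \<in> parts" "Y \<noteq> Y'" for Y Y'
  proof (rule ccontr)
    assume "Y \<inter> Y' \<noteq> {}"
    then obtain e where e: "e \<in> Y" "e \<in> Y'" by blast
    show False
    proof (cases "e \<subseteq> ?U")
      case True
      then have "e \<notin> D w" if "w \<in> V - ?U" for w using R_sub[OF that] unfolding D_def by blast
      then have "Y = {e}" "Y' = {e}" using YY(1,2) e unfolding parts_def by auto
      then show False using YY(3) by simp
    next
      case False
      then have "Y \<in> D ` (V - ?U)" "Y' \<in> D ` (V - ?U)"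
        using YY(1,2) e unfolding parts_def by auto
      then show False using D_eq e YY(3) by blast
    qed
  qed
  have fin: "finite T" if "spanning_forest E T" for T
    using that finite_edges unfolding spanning_forest_iff by blast
  have card_split: "card T = card (T \<inter> (E - Y)) + card (T \<inter> Y)" if "spanning_forest E T" for T Y
  proof -
    have "T = (T \<inter> (E - Y)) \<union> (T \<inter> Y)" using that unfolding spanning_forest_iff by blast
    moreover have "card ((T \<inter> (E - Y)) \<union> (T \<inter> Y)) = card (T \<inter> (E - Y)) + card (T \<inter> Y)"
      using fin[OF that] by (intro card_Un_disjoint) auto
    ultimately show ?thesis by simp
  qed
  \<comment> \<open>Otherwise \<open>T1\<close> and \<open>T0\<close> meet every part in equally
    many edges. The parts partition \<open>E - X\<close> and both forests have the same size, so
    they meet \<open>X\<close> equally often, and \<open>T1\<close> would be tight on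
    \<open>X\<close>.\<close>
  have "\<exists>Y\<in>parts. \<not> tight (E - Y) T1"
  proof (rule ccontr)
    assume "\<not> (\<exists>Y\<in>parts. \<not> tight (E - Y) T1)"
    then have t: "tight (E - Y) T1" if "Y \<in> parts" for Y using that by blast
    have eq: "card (T1 \<inter> Y) = card (T0 \<inter> Y)" if Y: "Y \<in> parts" for Y
    proof -
      have "card (T1 \<inter> (E - Y)) = card (T0 \<inter> (E - Y))"
        using tight_iff_card[OF T0(1) T1(1) part_tight[OF Y T0]] t[OF Y] by blast
      then show ?thesis
        using card_split[OF T0(1), of Y] card_split[OF T1(1), of Y] spanning_forest_card[OF T0(1) T1(1)] by simp
    qed
    have finp: "finite parts" unfolding parts_def using finite_E finite_V by simp
    have sum: "card (T \<inter> (E - X)) = (\<Sum>Y\<in>parts. card (T \<inter> Y))" if "spanning_forest E T" for T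
    proof -
      have "T \<inter> (E - X) = (\<Union>Y\<in>parts. T \<inter> Y)" using parts_Un by blast
      also have "card \<dots> = (\<Sum>Y\<in>parts. card (T \<inter> Y))"
        using finp fin[OF that] disj by (intro card_UN_disjoint) blast+
      finally show ?thesis .
    qed
    have "card (T1 \<inter> (E - X)) = card (T0 \<inter> (E - X))" using sum T0(1) T1(1) eq by simp
    then have "card (T1 \<inter> X) = card (T0 \<inter> X)"
      using card_split[OF T0(1), of X] card_split[OF T1(1), of X] spanning_forest_card[OF T0(1) T1(1)] by simp
    moreover have "tight X T0" using Xl T0 by blast
    ultimately have "tight X T1" using tight_iff_card[OF T0(1) T1(1) _ XE] by blast
    then show False using Xl T1 by blast
  qed
  then obtain Y where Y: "Y \<in> parts" "\<not> tight (E - Y) T1" by blast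
  \<comment> \<open>\<open>E - Y\<close> now replaces \<open>X\<close>. By the equal size of
    spanning forests, \<open>l\<close> becomes a function of \<open>card (T \<inter> Y)\<close>,
    which thus takes at least as many values.\<close>
  obtain m d :: real where md: "d > 0" "\<And>T. spanning_forest E T \<Longrightarrow> m - card (T \<inter> (E - Y)) = d * l (ind T)"
    using facet_from_tight[OF l Diff_subset part_tight[OF Y(1)] T1(1) Y(2)] by metis
  let ?S = "(\<lambda>T. card (T \<inter> Y)) ` {T. spanning_forest E T}"
  have finsf: "finite {T. spanning_forest E T}"
  proof (rule finite_subset)
    show "{T. spanning_forest E T} \<subseteq> Pow E" unfolding spanning_forest_def by blast
  qed (simp add: finite_E)
  have "l ` ?P \<subseteq> (\<lambda>n. (m - real (card T0) + real n) / d) ` ?S"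
  proof
    fix r assume "r \<in> l ` ?P"
    then obtain T where T: "spanning_forest E T" "r = l (ind T)" unfolding base_config_eq by blast
    have "card T0 = card (T \<inter> (E - Y)) + card (T \<inter> Y)"
      using card_split[OF T(1)] spanning_forest_card[OF T(1) T0(1)] by simp
    then have "m - real (card T0) + real (card (T \<inter> Y)) = d * r" using md(2)[OF T(1)] T(2) by simp
    then have "r = (m - real (card T0) + real (card (T \<inter> Y))) / d" using md(1) by (simp add: field_simps)
    then show "r \<in> (\<lambda>n. (m - real (card T0) + real n) / d) ` ?S" using T(1) by blast
  qed
  then have "card (l ` ?P) \<le> card ?S"
    using finsf by (meson surj_card_le finite_imageI)
  then have "k + 1 \<le> card ?S" using many by simp
  then obtain T T' where TT: "spanning_forest E T" "spanning_forest E T'" "card (T' \<inter> Y) \<ge> card (T \<inter> Y) + k"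
    using exists_gap[of ?S k] finsf by blast
  consider (loop) e where "Y = {e}" "e \<in> E" | (component) w where "Y = D w" "w \<in> V - ?U"
    using Y(1) unfolding parts_def by blast
  then show ?thesis
  proof cases
    case loop
    \<comment> \<open>A single edge allows only the counts 0 and 1, so \<open>k = 1\<close>. As
      \<open>T\<close> spans \<open>e\<close> without containing it, \<open>e\<close> lies on a
      cycle.\<close>
    have "card (T' \<inter> {e}) \<le> 1" using card_mono[of "{e}" "T' \<inter> {e}"] by simp
    then have "k = 1" "card (T \<inter> {e}) = 0" using TT(3) assms(2) loop(1) by auto
    then have "e \<notin> T" by auto
    obtain u v where e: "e = {u, v}" using loop(2) by (rule edgeE)
    have "reach T u v" "T \<subseteq> E - {{u, v}}"
      using TT(1) loop(2) \<open>e \<notin> T\<close> e unfolding spanning_forest_iff spans_def by blast+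
    then have "reach (E - {{u, v}}) u v" by (rule reach_mono)
    then show ?thesis using triangle_minor_if_cycle[OF assms(1)] loop(2) e \<open>k = 1\<close> by blast
  next
    case component
    define N where "N = {n \<in> ?U. \<exists>w\<in>R w. {n, w} \<in> E}"
    have "forest T'" using TT(2) unfolding spanning_forest_iff by blast
    then have "forest (T' \<inter> Y)" by (rule forest_subset) blast
    moreover have "q \<in> R w \<union> N" if "{p, q} \<in> E" "p \<in> R w" for p q
      using R_step[OF that _ component(2)] that unfolding N_def by (auto simp: insert_commute)
    moreover have "N \<subseteq> V" using UV unfolding N_def by blast
    moreover have "Y = {e \<in> E. e \<inter> R w \<noteq> {}}" using component(1) unfolding D_def .
    ultimately have "card (T' \<inter> Y) \<le> card (T \<inter> Y) + (card N - 1)"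
      using attachment_bound[OF TT(1), of "T' \<inter> Y" Y "R w" N] by blast
    \<comment> \<open>The subtraction in \<open>card N - 1\<close> is truncated;
      \<open>k \<ge> 1\<close> excludes an empty \<open>N\<close>.\<close>
    then have "k + 1 \<le> card N" using TT(3) assms(2) by simp
    then obtain N' where N': "N' \<subseteq> N" "card N' = k + 1" using obtain_subset_with_card_n by metis
    show ?thesis
    proof (rule cone_minor_if_attached[OF XE _ UV order_refl bi, of "R w" N'])
      show "finite ?U" using UV finite_V finite_subset by blast
      have "w \<in> R w" unfolding R_def by simp
      then show "R w \<noteq> {}" by blast
      show "R w \<subseteq> V" "R w \<inter> ?U = {}" using R_sub[OF component(2)] by blast+
      show "connected_graph (R w) (induced_edges E (R w))"
        unfolding R_def by (rule reach_class_connected) (auto simp: induced_edges_def)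
      show "N' \<subseteq> ?U" using N'(1) unfolding N_def by blast
      show "\<exists>x\<in>R w. {n, x} \<in> E" if "n \<in> N'" for n using that N'(1) unfolding N_def by blast
    qed (use N' assms(2) in auto)
  qed
qed

theorem theorem5p6:
  fixes k :: nat and V :: "'a set" and E :: "'a set set"
  assumes "k \<ge> 1" and "graph V E"
  shows "k_level_graph V E k \<longleftrightarrow>
    \<not> (\<exists>(VH :: nat set) (EH :: nat set set).
          graph VH EH \<and> card VH = k + 1 \<and> minimally_biconnected VH EH \<and>
          is_minor (cone_vertices VH) (cone_edges VH EH) V E)"
  using cone_minor_if_not_level[OF assms(2,1)] not_level_if_cone_minor[OF assms(2)] by blast

end
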